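(* Assume that $\beta$ is small, $\beta=\gamma\sqrt{\eta}$ with $\gamma\in\mathbb{R}$ fixed (so $\beta=0$ corresponds to $\gamma=0$). Then, as $\eta\to0^+$, $$r(\beta,\eta)\sim\eta\,R(\gamma),$$ where $R=R(\gamma)$ is the minimal positive solution of $$\gamma D_R(\gamma)=D_{1+R}(\gamma).$$
   Context: For $\beta\in\mathbb{R}$, $\eta>0$, consider the Markov diffusion process on $\mathbb{R}$ whose transition density $p$ satisfies $\partial_t p=-\partial_x[a(x)p]+\partial_x^2p$, with $a(x)=-\beta-\eta x$ for $x\ge0$ and $a(x)=-\beta-x$ for $x\le 0$, $p(x,0)=\delta(x-x_0)$, $p$ and $\partial_xp$ continuous at $x=0$, and decay as $x\to\pm\infty$. Its spectral gap $r(\beta,\eta)$ is the smallest strictly positive $\lambda$ for which $-\psi''+V\psi=(\lambda+\frac12)\psi$ on $\mathbb{R}$ has a nonzero solution $\psi\in L^2(\mathbb{R})$ with $\psi,\psi'$ continuous at $0$, where $V(x)=\frac14(\beta+x)^2$ for $x<0$ and $V(x)=\frac14(\beta+\eta x)^2+\frac{1-\eta}2$ for $x>0$. $D_\nu(z)=\frac{1}{i\sqrt{2\pi}}e^{z^2/4}\int_{\mathrm{Br}}u^\nu e^{-zu}e^{u^2/2}du$ is the parabolic cylinder function ($\mathrm{Br}$ an upward vertical line with $\mathrm{Re}(u)>0$, principal branch of $u^\nu$). Here $f\sim g$ means $f/g\to1$. *)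

theory Defs
  imports "HOL-Analysis.Analysis" "HOL-Library.Landau_Symbols"
begin

unbundle asymp_equiv_syntax

definition is_smallest_positive :: "(real \<Rightarrow> bool) \<Rightarrow> real \<Rightarrow> bool" where
  "is_smallest_positive P x \<longleftrightarrow> 0 < x \<and> P x \<and> (\<forall>y. 0 < y \<and> P y \<longrightarrow> x \<le> y)"

(* Symmetrising the generator f'' + a f' with drift a(x) = -\<beta> - \<eta> x (x \<ge> 0),
   a(x) = -\<beta> - x (x \<le> 0) gives the potential a^2/4 + a'/2 for x \<noteq> 0; it is shifted
   by 1/2 here, which the \<mu> + 1/2 in the eigenvalue equation compensates. The value at
   x = 0 is irrelevant: that equation is imposed only for x \<noteq> 0. *)
definition potential :: "real \<Rightarrow> real \<Rightarrow> real \<Rightarrow> real" where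
  "potential \<beta> \<eta> x =
     (if x < 0 then (\<beta> + x)\<^sup>2 / 4 else (\<beta> + \<eta> * x)\<^sup>2 / 4 + (1 - \<eta>) / 2)"

(* The potential jumps at 0, so the second derivative of \<psi> need not exist there.
   Real-valued \<psi> lose no generality, since the potential and \<mu> are real.
   Measurability of \<psi> follows from differentiability, so the last conjunct is
   membership in L^2. *)
definition is_eigenfunction :: "real \<Rightarrow> real \<Rightarrow> real \<Rightarrow> (real \<Rightarrow> real) \<Rightarrow> bool" where
  "is_eigenfunction \<beta> \<eta> \<mu> \<psi> \<longleftrightarrow>
     (\<forall>x. \<psi> differentiable (at x)) \<and>
     isCont \<psi> 0 \<and> isCont (deriv \<psi>) 0 \<and>
     (\<forall>x. x \<noteq> 0 \<longrightarrow>
        deriv \<psi> differentiable (at x) \<and>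
        - deriv (deriv \<psi>) x + potential \<beta> \<eta> x * \<psi> x = (\<mu> + 1/2) * \<psi> x) \<and>
     (\<exists>x. \<psi> x \<noteq> 0) \<and>
     integrable lborel (\<lambda>x. (\<psi> x)\<^sup>2)"

definition is_eigenvalue :: "real \<Rightarrow> real \<Rightarrow> real \<Rightarrow> bool" where
  "is_eigenvalue \<beta> \<eta> \<mu> \<longleftrightarrow> (\<exists>\<psi>. is_eigenfunction \<beta> \<eta> \<mu> \<psi>)"

definition spectral_gap :: "real \<Rightarrow> real \<Rightarrow> real" where
  "spectral_gap \<beta> \<eta> = (THE r. is_smallest_positive (is_eigenvalue \<beta> \<eta>) r)"

(* Integral of f along the upward vertical line Re u = c. *)
definition vertical_line_integral :: "real \<Rightarrow> (complex \<Rightarrow> complex) \<Rightarrow> complex" where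
  "vertical_line_integral c f = (LINT t|lborel. f (Complex c t) * \<i>)"

(* The parameter c is the abscissa of the Bromwich line; for c > 0 the value does not
   depend on it. *)
definition parabolic_cylinder :: "real \<Rightarrow> complex \<Rightarrow> complex \<Rightarrow> complex" where
  "parabolic_cylinder c \<nu> z =
     1 / (\<i> * complex_of_real (sqrt (2 * pi))) * exp (z\<^sup>2 / 4) *
     vertical_line_integral c (\<lambda>u. u powr \<nu> * exp (- (z * u)) * exp (u\<^sup>2 / 2))"

end

(* Shifting the Bromwich line shows that, up to the factor exp (z^2/4) / sqrt (2 pi), D_nu(z) is a
   real function cyl nu z with cyl nu' = - cyl (nu+1) and a three-term recurrence in nu. The equation
   for R thereby becomes cyl (R - 1) gamma = 0. An L^2 eigenfunction is proportional to a parabolic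
   cylinder function on each half line, because its constant Wronskian with the decaying solution must
   vanish; matching at 0 with lambda = eta nu and s = sqrt eta gives
     cyl (nu - 1) gamma * cyl (s^2 nu) (- gamma s) + s * cyl (s^2 nu - 1) (- gamma s) * cyl nu gamma = 0.
   The left side is jointly continuous in (s, nu) and at s = 0 it is a positive multiple of
   cyl (nu - 1) gamma. This function of nu changes sign at its first zero, by a Wronskian identity
   comparing two indices, so the smallest root for s > 0 converges to that zero. *)
theory Submission
  imports Defs "HOL-Probability.Distributions" "HOL-Real_Asymp.Real_Asymp"
begin

section \<open>Line integrals depending on a parameter\<close>

text \<open>The roots are followed through the limit s -> 0, so the eigenvalue condition must stay
  nondegenerate there and at \<nu> = 0. The raw Wronskian at the interface does not: it carries the
  factor s \<nu>, whose root \<nu> = 0 belongs to the stationary state. The recurrence splits this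
  factor off at the price of lowering an index, which is why positivity of \<open>cyl\<close> is
  needed for indices down to -1. Convergence of the smallest root takes two arguments: joint
  continuity over a compact range of indices excludes smaller roots, and a genuine sign change of
  the limit, not just a zero, forces a root nearby for s > 0. The sign change holds because the
  integral in the Wronskian identity tends to a positive weighted square norm. The freedom to move
  the Bromwich line serves the estimates: Re u = z makes the exponential real and positive, and an
  abscissa growing with z gives Gaussian decay, both without asymptotic expansions. Square
  integrability gives no pointwise decay of an eigenfunction or of its derivative, so the Wronskian
  is averaged over a unit interval instead of being evaluated at infinity.\<close>

lemma continuous_on_integral_param:
  fixes f :: "'c::metric_space \<Rightarrow> 'a \<Rightarrow> 'b::{banach,second_countable_topology}"
  assumes "\<And>x. x \<in> S \<Longrightarrow> f x \<in> borel_measurable M"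
    and "\<And>t. t \<in> space M \<Longrightarrow> continuous_on S (\<lambda>x. f x t)"
    and "\<And>x t. x \<in> S \<Longrightarrow> t \<in> space M \<Longrightarrow> norm (f x t) \<le> w t"
    and "integrable M w"
  shows "continuous_on S (\<lambda>x. integral\<^sup>L M (f x))"
  unfolding continuous_on_sequentially
proof (intro ballI allI impI, elim conjE)
  fix X :: "nat \<Rightarrow> 'c" and a assume a: "a \<in> S" and XS: "\<forall>n. X n \<in> S" and X: "X \<longlonglongrightarrow> a"
  have "(\<lambda>n. integral\<^sup>L M (f (X n))) \<longlonglongrightarrow> integral\<^sup>L M (f a)"
  proof (rule integral_dominated_convergence[where w = w])
    show "AE t in M. (\<lambda>n. f (X n) t) \<longlonglongrightarrow> f a t"
    proof (rule AE_I2)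
      fix t assume "t \<in> space M"
      from assms(2)[OF this] show "(\<lambda>n. f (X n) t) \<longlonglongrightarrow> f a t"
        unfolding continuous_on_sequentially using a XS X by (auto simp: o_def)
    qed
  qed (use assms XS a in auto)
  then show "((\<lambda>x. integral\<^sup>L M (f x)) \<circ> X) \<longlonglongrightarrow> integral\<^sup>L M (f a)"
    by (simp add: o_def)
qed

text \<open>The difference quotient form of the derivative, to which dominated convergence applies
  directly.\<close>

lemma has_vector_derivative_within_iff_tendsto:
  fixes f :: "real \<Rightarrow> 'b::real_normed_vector"
  shows "(f has_vector_derivative D) (at a within S) \<longleftrightarrow>
         ((\<lambda>x. (f x - f a) /\<^sub>R (x - a)) \<longlongrightarrow> D) (at a within S)"
proof -
  have "(f has_vector_derivative D) (at a within S) \<longleftrightarrow>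
      ((\<lambda>x. norm (f x - f a - (x - a) *\<^sub>R D) / norm (x - a)) \<longlongrightarrow> 0) (at a within S)"
    unfolding has_vector_derivative_def has_derivative_iff_norm
    by (simp add: bounded_linear_scaleR_left)
  also have "\<dots> \<longleftrightarrow> ((\<lambda>x. norm ((f x - f a) /\<^sub>R (x - a) - D)) \<longlongrightarrow> 0) (at a within S)"
  proof (rule filterlim_cong[OF refl refl])
    have "norm (f x - f a - (x - a) *\<^sub>R D) / norm (x - a) = norm ((f x - f a) /\<^sub>R (x - a) - D)"
      if "x \<noteq> a" for x
    proof -
      have "(f x - f a) /\<^sub>R (x - a) - D = (f x - f a - (x - a) *\<^sub>R D) /\<^sub>R (x - a)"
        using that by (simp add: scaleR_diff_right)
      then show ?thesis by (simp add: divide_inverse_commute)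
    qed
    then show "\<forall>\<^sub>F x in at a within S. norm (f x - f a - (x - a) *\<^sub>R D) / norm (x - a) =
        norm ((f x - f a) /\<^sub>R (x - a) - D)"
      by (simp add: eventually_at_filter)
  qed
  also have "\<dots> \<longleftrightarrow> ((\<lambda>x. (f x - f a) /\<^sub>R (x - a)) \<longlongrightarrow> D) (at a within S)"
    by (simp add: tendsto_norm_zero_iff LIM_zero_iff)
  finally show ?thesis .
qed

text \<open>The mean value inequality on the convex set \<open>S\<close> turns the bound on
  \<open>f'\<close> into the same bound \<open>w\<close> on all difference quotients, so dominated
  convergence applies along every sequence tending to \<open>a\<close>.\<close>

lemma has_vector_derivative_integral_param:
  fixes f f' :: "real \<Rightarrow> 'a \<Rightarrow> 'b::{banach,second_countable_topology}"
  assumes S: "open S" "convex S" "a \<in> S"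
    and der: "\<And>x t. x \<in> S \<Longrightarrow> t \<in> space M \<Longrightarrow> ((\<lambda>x. f x t) has_vector_derivative f' x t) (at x)"
    and int: "\<And>x. x \<in> S \<Longrightarrow> integrable M (f x)"
    and meas: "f' a \<in> borel_measurable M"
    and bnd: "\<And>x t. x \<in> S \<Longrightarrow> t \<in> space M \<Longrightarrow> norm (f' x t) \<le> w t"
    and w: "integrable M w"
  shows "((\<lambda>x. integral\<^sup>L M (f x)) has_vector_derivative integral\<^sup>L M (f' a)) (at a)"
proof -
  have quot: "norm ((f x t - f a t) /\<^sub>R (x - a)) \<le> w t" if "x \<in> S" "x \<noteq> a" "t \<in> space M" for x t
  proof -
    have "norm (f x t - f a t) \<le> w t * norm (x - a)"
    proof (rule differentiable_bound[OF S(2)])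
      fix y assume y: "y \<in> S"
      show "((\<lambda>x. f x t) has_derivative (\<lambda>h. h *\<^sub>R f' y t)) (at y within S)"
        using der[OF y \<open>t \<in> space M\<close>] unfolding has_vector_derivative_def
        by (rule has_derivative_at_withinI)
      show "onorm (\<lambda>h. h *\<^sub>R f' y t) \<le> w t"
        using bnd[OF y \<open>t \<in> space M\<close>]
        by (intro onorm_le) (auto simp: mult.commute[of "w t"] intro: mult_left_mono)
    qed (use S that in auto)
    then have "norm (f x t - f a t) / \<bar>x - a\<bar> \<le> w t"
      using that by (simp add: pos_divide_le_eq)
    then show ?thesis using that by (simp add: divide_inverse mult.commute)
  qed
  have "((\<lambda>x. (integral\<^sup>L M (f x) - integral\<^sup>L M (f a)) /\<^sub>R (x - a)) \<longlongrightarrow> integral\<^sup>L M (f' a)) (at a within S)"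
    unfolding tendsto_at_iff_sequentially
  proof (intro allI impI)
    fix X :: "nat \<Rightarrow> real" assume XS: "\<forall>i. X i \<in> S - {a}" and X: "X \<longlonglongrightarrow> a"
    have lim: "(\<lambda>n. \<integral>t. (f (X n) t - f a t) /\<^sub>R (X n - a) \<partial>M) \<longlonglongrightarrow> integral\<^sup>L M (f' a)"
    proof (rule integral_dominated_convergence[where w = w])
      show "AE t in M. (\<lambda>n. (f (X n) t - f a t) /\<^sub>R (X n - a)) \<longlonglongrightarrow> f' a t"
      proof (rule AE_I2)
        fix t assume "t \<in> space M"
        from has_vector_derivative_at_within[OF der[OF S(3) this], of S]
        have "((\<lambda>x. (f x t - f a t) /\<^sub>R (x - a)) \<longlongrightarrow> f' a t) (at a within S)"
          by (simp only: has_vector_derivative_within_iff_tendsto)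
        then show "(\<lambda>n. (f (X n) t - f a t) /\<^sub>R (X n - a)) \<longlonglongrightarrow> f' a t"
          using XS X unfolding tendsto_at_iff_sequentially by (auto simp: o_def)
      qed
      show "(\<lambda>t. (f (X n) t - f a t) /\<^sub>R (X n - a)) \<in> borel_measurable M" for n
        using int[of "X n"] int[OF S(3)] XS by auto
      show "AE t in M. norm ((f (X n) t - f a t) /\<^sub>R (X n - a)) \<le> w t" for n
        using XS quot by auto
    qed (use meas w in auto)
    have eq: "(\<integral>t. (f (X n) t - f a t) /\<^sub>R (X n - a) \<partial>M)
        = (integral\<^sup>L M (f (X n)) - integral\<^sup>L M (f a)) /\<^sub>R (X n - a)" for n
      using int[of "X n"] int[OF S(3)] XS by simp
    show "((\<lambda>x. (integral\<^sup>L M (f x) - integral\<^sup>L M (f a)) /\<^sub>R (x - a)) \<circ> X) \<longlonglongrightarrow> integral\<^sup>L M (f' a)"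
      using lim unfolding eq o_def .
  qed
  then show ?thesis
    unfolding has_vector_derivative_within_iff_tendsto at_within_open[OF S(3) S(1)] .
qed

text \<open>Integration by parts with vanishing boundary terms; with \<open>F\<close> the integrand
  on a Bromwich line it produces the recurrence in the index.\<close>

lemma integral_deriv_eq_0:
  fixes F f :: "real \<Rightarrow> 'a::euclidean_space"
  assumes "\<And>x. (F has_vector_derivative f x) (at x)" "\<And>x. isCont f x" "integrable lborel f"
    and "(F \<longlongrightarrow> 0) at_bot" "(F \<longlongrightarrow> 0) at_top"
  shows "integral\<^sup>L lborel f = 0"
proof -
  have "(LBINT x=-\<infinity>..\<infinity>. f x) = 0 - 0"
    by (rule interval_integral_FTC_integrable[where F = F])
       (use assms in \<open>auto simp: ereal_tendsto_simps set_integrable_def\<close>)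
  then show ?thesis
    by (simp add: interval_lebesgue_integral_def set_lebesgue_integral_def)
qed

text \<open>On a vertical line the integrand decays like exp (-t^2/2). Half of that exponent is
  given up to absorb a factor exp |t|, by |t| \<le> 1 + t^2/4; what remains is this
  function.\<close>

definition gauss :: "real \<Rightarrow> real" where "gauss t = exp (1 - t\<^sup>2 / 4)"

lemma integrable_gauss: "integrable lborel gauss"
proof -
  have "integrable lborel (\<lambda>t. (exp 1 * sqrt (2 * pi * (sqrt 2)\<^sup>2)) * normal_density 0 (sqrt 2) t)"
    by (intro integrable_mult_right integrable_normal_density) auto
  moreover have "(\<lambda>t. (exp 1 * sqrt (2 * pi * (sqrt 2)\<^sup>2)) * normal_density 0 (sqrt 2) t) = gauss"
    unfolding fun_eq_iff normal_density_def gauss_def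
    by (simp add: exp_diff exp_minus field_simps flip: exp_add)
  ultimately show ?thesis by (simp only:)
qed

lemma gauss_tendsto_0: "(gauss \<longlongrightarrow> 0) at_top" "(gauss \<longlongrightarrow> 0) at_bot"
  unfolding gauss_def by real_asymp+

section \<open>The Bromwich integrand: domination and derivatives\<close>

definition kern :: "real \<Rightarrow> real \<Rightarrow> complex \<Rightarrow> complex" where
  "kern \<nu> z u = u powr of_real \<nu> * exp (- (of_real z * u)) * exp (u\<^sup>2 / 2)"

lemma norm_kern:
  assumes "c > 0"
  shows "norm (kern \<nu> z (Complex c t)) = cmod (Complex c t) powr \<nu> * exp (- z * c + (c\<^sup>2 - t\<^sup>2) / 2)"
proof -
  have "norm (kern \<nu> z (Complex c t)) = cmod (Complex c t) powr \<nu> * (exp (- z * c) * exp ((c\<^sup>2 - t\<^sup>2) / 2))"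
    by (simp add: kern_def norm_mult norm_powr_real_powr' power2_eq_square)
  then show ?thesis by (simp only: exp_add)
qed

text \<open>Put y = x + 1/x. Both x and 1/x are at most y, and y \<ge> 1, so either sign of \<nu>
  leads to y^M; the single term y^M / M! of the exponential series bounds that power.\<close>

lemma powr_le_fact_exp:
  assumes "x > 0" "\<bar>\<nu>\<bar> \<le> real M"
  shows "x powr \<nu> \<le> fact M * exp (x + 1 / x)"
proof -
  have pos: "x + 1/x \<ge> 1"
  proof (cases "x \<ge> 1")
    case True with assms show ?thesis by (simp add: add_increasing2)
  next
    case False with assms have "1/x \<ge> 1" by simp
    with assms show ?thesis by linarith
  qed
  have "x powr \<nu> \<le> (x + 1/x) powr \<bar>\<nu>\<bar>"
  proof (cases "\<nu> \<ge> 0")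
    case True
    then show ?thesis using assms by (auto intro!: powr_mono2)
  next
    case False
    then have "x powr \<nu> = (1/x) powr \<bar>\<nu>\<bar>"
      using assms by (simp add: powr_divide powr_minus_divide[symmetric])
    also have "\<dots> \<le> (x + 1/x) powr \<bar>\<nu>\<bar>" using assms by (intro powr_mono2) auto
    finally show ?thesis .
  qed
  also have "\<dots> \<le> (x + 1/x) powr real M" using assms pos by (intro powr_mono) auto
  also have "\<dots> = (x + 1/x) ^ M" using pos by (simp add: powr_realpow)
  also have "\<dots> \<le> fact M * exp (x + 1/x)"
  proof -
    have "(\<Sum>n\<in>{M}. inverse (fact n) * (x + 1/x) ^ n) \<le> (\<Sum>n. inverse (fact n) * (x + 1/x) ^ n)"
      using pos summable_exp[of "x + 1/x"]
      by (intro sum_le_suminf) (auto)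
    then show ?thesis using pos by (simp add: exp_def field_simps)
  qed
  finally show ?thesis .
qed

text \<open>Since |u| lies between c and c + |t|, the power of u costs at most a factor exp |t|
  beyond constants. The bound is uniform in |\<nu>| \<le> M and separates t from z and c, so it
  provides dominating functions for limits in each of \<nu>, z and c.\<close>

lemma norm_kern_le:
  assumes c: "c > 0" and M: "\<bar>\<nu>\<bar> \<le> real M"
  shows "norm (kern \<nu> z (Complex c t)) \<le> fact M * exp (c + 1 / c - z * c + c\<^sup>2 / 2) * gauss t"
proof -
  have n: "cmod (Complex c t) \<ge> c" using complex_Re_le_cmod[of "Complex c t"] by simp
  have n2: "cmod (Complex c t) \<le> c + \<bar>t\<bar>" using c cmod_le[of "Complex c t"] by simp
  have n3: "1 / cmod (Complex c t) \<le> 1 / c" using n c by (simp add: frac_le)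
  have "cmod (Complex c t) powr \<nu> \<le> fact M * exp (cmod (Complex c t) + 1 / cmod (Complex c t))"
    using n c M by (intro powr_le_fact_exp) auto
  also have "\<dots> \<le> fact M * exp (c + \<bar>t\<bar> + 1 / c)" using n2 n3 by (intro mult_left_mono) auto
  also have "\<dots> \<le> fact M * exp (c + 1 / c + (1 + t\<^sup>2 / 4))"
  proof -
    have "\<bar>t\<bar> \<le> 1 + t\<^sup>2 / 4" using zero_le_power2[of "\<bar>t\<bar> / 2 - 1"]
      by (simp add: power2_diff power_divide)
    then show ?thesis by (intro mult_left_mono) auto
  qed
  finally have "norm (kern \<nu> z (Complex c t)) \<le>
      (fact M * exp (c + 1 / c + (1 + t\<^sup>2 / 4))) * exp (- z * c + (c\<^sup>2 - t\<^sup>2) / 2)"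
    unfolding norm_kern[OF c] by (intro mult_right_mono) auto
  also have "\<dots> = fact M * exp (c + 1 / c - z * c + c\<^sup>2 / 2) * gauss t"
    unfolding gauss_def by (simp add: mult.assoc field_simps flip: exp_add)
  finally show ?thesis .
qed

text \<open>Multiplying by u or 1/u shifts the index by one, so the u-derivative is a combination of
  three kernels. Integrated along a vertical line it yields both the recurrence and the independence
  of the abscissa.\<close>

lemma kern_has_field_derivative:
  assumes "Re u > 0"
  shows "(kern \<nu> z has_field_derivative
     (of_real \<nu> * kern (\<nu> - 1) z u - of_real z * kern \<nu> z u + kern (\<nu> + 1) z u)) (at u)"
proof -
  have u: "u \<notin> \<real>\<^sub>\<le>\<^sub>0" "u \<noteq> 0" using assms by (auto simp: complex_nonpos_Reals_iff)
  have p: "u powr (of_real \<nu> + 1) = u powr of_real \<nu> * u"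
    using u by (simp add: powr_add)
  have "((\<lambda>u. u powr of_real \<nu>) has_field_derivative of_real \<nu> * u powr (of_real \<nu> - 1)) (at u)"
    using u(1) by (rule has_field_derivative_powr)
  moreover have "((\<lambda>u. exp (- (of_real z * u))) has_field_derivative - of_real z * exp (- (of_real z * u))) (at u)"
    by (auto intro!: derivative_eq_intros)
  moreover have "((\<lambda>u. exp (u\<^sup>2 / 2)) has_field_derivative u * exp (u\<^sup>2 / 2)) (at u)"
    by (auto intro!: derivative_eq_intros)
  ultimately show ?thesis
    unfolding kern_def
    by (rule DERIV_mult[OF DERIV_mult, THEN DERIV_cong]) (simp add: p, simp add: algebra_simps)
qed

lemma kern_line_has_vector_derivative:
  assumes "c > 0"
  shows "((\<lambda>t. kern \<nu> z (Complex c t)) has_vector_derivative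
     \<i> * (of_real \<nu> * kern (\<nu> - 1) z (Complex c t) - of_real z * kern \<nu> z (Complex c t)
          + kern (\<nu> + 1) z (Complex c t))) (at t)"
    and "((\<lambda>c. kern \<nu> z (Complex c t)) has_vector_derivative
     (of_real \<nu> * kern (\<nu> - 1) z (Complex c t) - of_real z * kern \<nu> z (Complex c t)
          + kern (\<nu> + 1) z (Complex c t))) (at c)"
proof -
  have 1: "((\<lambda>t. Complex c t) has_vector_derivative \<i>) (at t)"
    unfolding Complex_eq by (auto intro!: derivative_eq_intros)
  have 2: "((\<lambda>c. Complex c t) has_vector_derivative 1) (at c)"
    unfolding Complex_eq by (auto intro!: derivative_eq_intros)
  have k: "(kern \<nu> z has_field_derivative
     (of_real \<nu> * kern (\<nu> - 1) z (Complex c t) - of_real z * kern \<nu> z (Complex c t)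
        + kern (\<nu> + 1) z (Complex c t))) (at (Complex c t))"
    using assms by (intro kern_has_field_derivative) auto
  show "((\<lambda>t. kern \<nu> z (Complex c t)) has_vector_derivative
     \<i> * (of_real \<nu> * kern (\<nu> - 1) z (Complex c t) - of_real z * kern \<nu> z (Complex c t)
          + kern (\<nu> + 1) z (Complex c t))) (at t)"
    using field_vector_diff_chain_at[OF 1 k] by (simp add: o_def)
  show "((\<lambda>c. kern \<nu> z (Complex c t)) has_vector_derivative
     (of_real \<nu> * kern (\<nu> - 1) z (Complex c t) - of_real z * kern \<nu> z (Complex c t)
          + kern (\<nu> + 1) z (Complex c t))) (at c)"
    using field_vector_diff_chain_at[OF 2 k] by (simp add: o_def)
qed

lemma kern_z_has_vector_derivative:
  assumes "Re u > 0"
  shows "((\<lambda>z. kern \<nu> z u) has_vector_derivative - kern (\<nu> + 1) z u) (at z)"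
proof -
  have "u \<noteq> 0" using assms by auto
  have "((\<lambda>w. exp (- (w * u))) has_field_derivative - u * exp (- (of_real z * u))) (at (of_real z))"
    by (auto intro!: derivative_eq_intros)
  moreover have "(of_real has_vector_derivative (1::complex)) (at z)"
    using has_vector_derivative_of_real[OF DERIV_ident] by (simp add: id_def)
  ultimately have "((\<lambda>z. exp (- (of_real z * u))) has_vector_derivative - u * exp (- (of_real z * u))) (at z)"
    using field_vector_diff_chain_at[of complex_of_real 1 z] by (fastforce simp: o_def)
  from has_vector_derivative_mult_left[OF has_vector_derivative_mult_right[OF this]]
  have "((\<lambda>z. kern \<nu> z u) has_vector_derivative
     u powr of_real \<nu> * (- u * exp (- (of_real z * u))) * exp (u\<^sup>2 / 2)) (at z)"
    unfolding kern_def .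
  moreover have "u powr of_real (\<nu> + 1) = u powr of_real \<nu> * u"
    using \<open>u \<noteq> 0\<close> by (simp add: powr_add)
  ultimately show ?thesis by (simp add: kern_def mult.assoc mult.left_commute)
qed

lemma isCont_kern_line:
  assumes "c > 0" shows "isCont (\<lambda>t. kern \<nu> z (Complex c t)) t"
  by (rule has_vector_derivative_continuous[OF kern_line_has_vector_derivative(1)[OF assms]])

lemma integrable_kern:
  assumes c: "c > 0"
  shows "integrable lborel (\<lambda>t. kern \<nu> z (Complex c t))"
proof -
  obtain M :: nat where M: "\<bar>\<nu>\<bar> \<le> real M" using real_arch_simple by blast
  show ?thesis
  proof (rule Bochner_Integration.integrable_bound)
    show "integrable lborel (\<lambda>t. fact M * exp (c + 1 / c - z * c + c\<^sup>2 / 2) * gauss t)"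
      using integrable_gauss by simp
    show "(\<lambda>t. kern \<nu> z (Complex c t)) \<in> borel_measurable lborel"
      using isCont_kern_line[OF c]
      by (simp add: borel_measurable_continuous_onI continuous_at_imp_continuous_on)
    show "AE t in lborel. norm (kern \<nu> z (Complex c t)) \<le>
        norm (fact M * exp (c + 1 / c - z * c + c\<^sup>2 / 2) * gauss t)"
      using norm_kern_le[OF c M, of z] by (intro AE_I2) (auto simp: gauss_def abs_mult)
  qed
qed

lemma kern_line_tendsto_0:
  assumes c: "c > 0" and F: "(gauss \<longlongrightarrow> 0) F"
  shows "((\<lambda>t. kern \<nu> z (Complex c t)) \<longlongrightarrow> 0) F"
proof -
  obtain M :: nat where M: "\<bar>\<nu>\<bar> \<le> real M" using real_arch_simple by blast
  show ?thesis
    by (rule Lim_null_comparison[OF always_eventually[OF allI[OF norm_kern_le[OF c M]]]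
          tendsto_mult_right_zero[OF F]])
qed

section \<open>The Bromwich integral: recurrence, derivative and independence of the line\<close>

definition cyl_line :: "real \<Rightarrow> real \<Rightarrow> real \<Rightarrow> complex" where
  "cyl_line c \<nu> z = (\<integral>t. kern \<nu> z (Complex c t) \<partial>lborel)"

lemma cyl_line_recurrence:
  assumes c: "c > 0"
  shows "of_real \<nu> * cyl_line c (\<nu> - 1) z - of_real z * cyl_line c \<nu> z + cyl_line c (\<nu> + 1) z = 0"
proof -
  have "(\<integral>t. \<i> * (of_real \<nu> * kern (\<nu> - 1) z (Complex c t) - of_real z * kern \<nu> z (Complex c t)
          + kern (\<nu> + 1) z (Complex c t)) \<partial>lborel) = 0"
    by (rule integral_deriv_eq_0[OF kern_line_has_vector_derivative(1)[OF c]])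
       (intro continuous_intros isCont_kern_line c integrable_mult_right
         Bochner_Integration.integrable_add Bochner_Integration.integrable_diff integrable_kern
         kern_line_tendsto_0 gauss_tendsto_0)+
  then show ?thesis
    using integrable_kern[OF c] by (simp add: cyl_line_def)
qed

lemma cyl_line_has_vector_derivative:
  assumes c: "c > 0"
  shows "(cyl_line c \<nu> has_vector_derivative - cyl_line c (\<nu> + 1) z) (at z)"
proof -
  obtain M :: nat where M: "\<bar>\<nu> + 1\<bar> \<le> real M" using real_arch_simple by blast
  have "((\<lambda>z. \<integral>t. kern \<nu> z (Complex c t) \<partial>lborel) has_vector_derivative
      (\<integral>t. - kern (\<nu> + 1) z (Complex c t) \<partial>lborel)) (at z)"
  proof (rule has_vector_derivative_integral_param[where S = "{z - 1<..<z + 1}"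
        and w = "\<lambda>t. fact M * exp (c + 1 / c - (z - 1) * c + c\<^sup>2 / 2) * gauss t"])
    fix x t assume x: "x \<in> {z - 1<..<z + 1}"
    have "norm (kern (\<nu> + 1) x (Complex c t)) \<le> fact M * exp (c + 1 / c - x * c + c\<^sup>2 / 2) * gauss t"
      by (rule norm_kern_le[OF c M])
    also have "\<dots> \<le> fact M * exp (c + 1 / c - (z - 1) * c + c\<^sup>2 / 2) * gauss t"
      using x c by (intro mult_right_mono mult_left_mono) (auto simp: gauss_def)
    finally show "norm (- kern (\<nu> + 1) x (Complex c t)) \<le>
        fact M * exp (c + 1 / c - (z - 1) * c + c\<^sup>2 / 2) * gauss t" by simp
    show "((\<lambda>x. kern \<nu> x (Complex c t)) has_vector_derivative - kern (\<nu> + 1) x (Complex c t)) (at x)"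
      using c by (intro kern_z_has_vector_derivative) auto
  qed (use integrable_kern[OF c] integrable_gauss in auto)
  then show ?thesis by (simp add: cyl_line_def[abs_def])
qed

text \<open>Differentiating in c under the integral sign gives exactly the left side of
  \<open>cyl_line_recurrence\<close>, which is zero. No contour needs to be closed.\<close>

lemma cyl_line_indep:
  assumes "c > 0" "d > 0"
  shows "cyl_line c \<nu> z = cyl_line d \<nu> z"
proof -
  obtain M :: nat where "\<bar>\<nu>\<bar> + 1 \<le> real M" using real_arch_simple by blast
  then have M: "\<bar>\<nu> - 1\<bar> \<le> real M" "\<bar>\<nu>\<bar> \<le> real M" "\<bar>\<nu> + 1\<bar> \<le> real M" by linarith+
  define g where "g c t = of_real \<nu> * kern (\<nu> - 1) z (Complex c t) - of_real z * kern \<nu> z (Complex c t)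
          + kern (\<nu> + 1) z (Complex c t)" for c t
  have "((\<lambda>c. cyl_line c \<nu> z) has_vector_derivative 0) (at c)" if c: "c > 0" for c
  proof -
    \<comment> \<open>One constant for all abscissas x in (c/2, 2c), where x < 2c and 1/x < 2/c; it
      majorises the factor in \<open>norm_kern_le\<close>.\<close>
    define C where "C = fact M * exp (2 * c + 2 / c + \<bar>z\<bar> * (2 * c) + (2 * c)\<^sup>2 / 2)"
    have "((\<lambda>c. \<integral>t. kern \<nu> z (Complex c t) \<partial>lborel) has_vector_derivative
        (\<integral>t. g c t \<partial>lborel)) (at c)"
    proof (rule has_vector_derivative_integral_param[where S = "{c/2<..<2 * c}"
          and w = "\<lambda>t. (\<bar>\<nu>\<bar> + \<bar>z\<bar> + 1) * (C * gauss t)"])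
      fix x t assume x: "x \<in> {c/2<..<2 * c}"
      then have x0: "x > 0" using c by auto
      show "((\<lambda>c. kern \<nu> z (Complex c t)) has_vector_derivative g x t) (at x)"
        unfolding g_def by (rule kern_line_has_vector_derivative(2)[OF x0])
      have *: "norm (kern \<mu> z (Complex x t)) \<le> C * gauss t" if "\<bar>\<mu>\<bar> \<le> real M" for \<mu>
      proof -
        have "norm (kern \<mu> z (Complex x t)) \<le> fact M * exp (x + 1 / x - z * x + x\<^sup>2 / 2) * gauss t"
          by (rule norm_kern_le[OF x0 that])
        also have "\<dots> \<le> C * gauss t"
        proof -
          have "1 / x \<le> 2 / c" using x c x0 frac_le[of 1 1 "c / 2" x] by simp
          moreover have "- z * x \<le> \<bar>z\<bar> * (2 * c)"
            using x x0 by (intro mult_mono) auto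
          moreover have "x\<^sup>2 / 2 \<le> (2 * c)\<^sup>2 / 2"
            using x x0 by (intro divide_right_mono power_mono) auto
          ultimately have "x + 1 / x - z * x + x\<^sup>2 / 2 \<le> 2 * c + 2 / c + \<bar>z\<bar> * (2 * c) + (2 * c)\<^sup>2 / 2"
            using x by auto
          then show ?thesis
            unfolding C_def by (intro mult_right_mono mult_left_mono) (auto simp: gauss_def)
        qed
        finally show ?thesis .
      qed
      have "norm (g x t) \<le> \<bar>\<nu>\<bar> * norm (kern (\<nu> - 1) z (Complex x t)) +
          \<bar>z\<bar> * norm (kern \<nu> z (Complex x t)) + norm (kern (\<nu> + 1) z (Complex x t))"
        unfolding g_def
        by (intro norm_triangle_le add_mono norm_triangle_le_diff) (auto simp: norm_mult)
      also have "\<dots> \<le> \<bar>\<nu>\<bar> * (C * gauss t) + \<bar>z\<bar> * (C * gauss t) + C * gauss t"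
        by (intro add_mono mult_left_mono * M) auto
      finally show "norm (g x t) \<le> (\<bar>\<nu>\<bar> + \<bar>z\<bar> + 1) * (C * gauss t)"
        by (simp add: algebra_simps)
    next
      show "g c \<in> borel_measurable lborel"
        unfolding g_def using integrable_kern[OF c] by measurable
    qed (use integrable_kern[of _ \<nu> z] integrable_gauss c in auto)
    moreover have "(\<integral>t. g c t \<partial>lborel) = 0"
      using cyl_line_recurrence[OF c, of \<nu> z] integrable_kern[OF c]
      by (simp add: cyl_line_def g_def)
    ultimately show ?thesis by (simp add: cyl_line_def[abs_def])
  qed
  then have "\<And>c. c \<in> {0<..} \<Longrightarrow> ((\<lambda>c. cyl_line c \<nu> z) has_vector_derivative 0) (at c within {0<..})"
    by (auto intro: has_vector_derivative_at_within)
  from has_vector_derivative_zero_constant[OF _ this] obtain k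
    where "\<And>c. c \<in> {0<..} \<Longrightarrow> cyl_line c \<nu> z = k" by auto
  with assms show ?thesis by simp
qed

section \<open>Real parabolic cylinder functions\<close>

text \<open>The abscissa 1 and the real part lose nothing, by \<open>cyl_line_eq_cyl\<close>. For a
  natural number n, \<open>cyl n z\<close> is sqrt (2 pi) exp (-z^2/2) He_n(z) with He_n the
  probabilists' Hermite polynomial.\<close>

definition cyl :: "real \<Rightarrow> real \<Rightarrow> real" where
  "cyl \<nu> z = Re (cyl_line 1 \<nu> z)"

text \<open>As \<nu> and z are real, conjugating the integrand amounts to replacing t by -t, which
  leaves the integral unchanged.\<close>

lemma cyl_line_eq_cyl:
  assumes c: "c > 0"
  shows "cyl_line c \<nu> z = of_real (cyl \<nu> z)"
proof -
  have k: "cnj (kern \<nu> z (Complex 1 t)) = kern \<nu> z (Complex 1 (- t))" for t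
    by (simp add: kern_def cnj_powr exp_cnj flip: complex_cnj)
  have "cnj (cyl_line 1 \<nu> z) = (\<integral>t. cnj (kern \<nu> z (Complex 1 t)) \<partial>lborel)"
    unfolding cyl_line_def by (rule Bochner_Integration.integral_cnj[symmetric])
  also have "\<dots> = (\<integral>t. kern \<nu> z (Complex 1 (- t)) \<partial>lborel)"
    by (simp only: k)
  also have "\<dots> = cyl_line 1 \<nu> z"
    unfolding cyl_line_def
    using lborel_integral_real_affine[of "-1" "\<lambda>t. kern \<nu> z (Complex 1 t)" 0] by simp
  finally have "cyl_line 1 \<nu> z \<in> \<real>" by (simp add: Reals_cnj_iff)
  then show ?thesis
    using cyl_line_indep[OF c, of 1] by (simp add: cyl_def)
qed

lemma parabolic_cylinder_eq_cyl:
  assumes "c > 0"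
  shows "parabolic_cylinder c (of_real \<nu>) (of_real z) =
         of_real (exp (z\<^sup>2 / 4) / sqrt (2 * pi) * cyl \<nu> z)"
proof -
  have "vertical_line_integral c (\<lambda>u. u powr of_real \<nu> * exp (- (of_real z * u)) * exp (u\<^sup>2 / 2))
      = cyl_line c \<nu> z * \<i>"
    unfolding vertical_line_integral_def cyl_line_def kern_def by simp
  then show ?thesis
    using cyl_line_eq_cyl[OF assms, of \<nu> z]
    by (simp add: parabolic_cylinder_def exp_of_real[symmetric] field_simps)
qed

lemma cyl_recurrence: "\<nu> * cyl (\<nu> - 1) z = z * cyl \<nu> z - cyl (\<nu> + 1) z"
proof -
  have "of_real (\<nu> * cyl (\<nu> - 1) z - z * cyl \<nu> z + cyl (\<nu> + 1) z) = (0::complex)"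
    using cyl_line_recurrence[of 1 \<nu> z] by (simp add: cyl_line_eq_cyl)
  then show ?thesis unfolding of_real_eq_0_iff by simp
qed

lemma DERIV_cyl [derivative_intros]:
  assumes "(f has_field_derivative f') (at x within S)"
  shows "((\<lambda>x. cyl \<nu> (f x)) has_field_derivative - cyl (\<nu> + 1) (f x) * f') (at x within S)"
proof -
  have "((\<lambda>z. Re (cyl_line 1 \<nu> z)) has_vector_derivative Re (- cyl_line 1 (\<nu> + 1) z)) (at z)" for z
    by (rule bounded_linear.has_vector_derivative[OF bounded_linear_Re cyl_line_has_vector_derivative]) simp
  then have "(cyl \<nu> has_field_derivative - cyl (\<nu> + 1) z) (at z)" for z
    by (simp add: cyl_def[abs_def] has_real_derivative_iff_has_vector_derivative)
  from DERIV_chain2[OF this assms] show ?thesis .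
qed

text \<open>Index and argument of \<open>cyl\<close> move together in the matching condition, hence
  joint continuity. The domination is uniform only on bounded sets, so the plane is exhausted by
  balls.\<close>

lemma continuous_on_cyl_pair: "continuous_on UNIV (\<lambda>(\<nu>, z). cyl \<nu> z)"
proof -
  have "continuous_on (ball 0 r) (\<lambda>p. cyl_line 1 (fst p) (snd p))" for r
  proof -
    obtain M :: nat where M: "r \<le> real M" using real_arch_simple by blast
    show ?thesis
      unfolding cyl_line_def
    \<comment> \<open>The 5/2 is c + 1/c + c^2/2 at c = 1, and \<open>real M\<close> bounds -z on
      the ball.\<close>
    proof (rule continuous_on_integral_param[where w = "\<lambda>t. fact M * exp (5/2 + real M) * gauss t"])
      fix p :: "real \<times> real" and t assume p: "p \<in> ball 0 r"
      have "\<bar>fst p\<bar> \<le> real M" "\<bar>snd p\<bar> \<le> real M"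
        using p M norm_fst_le[of "fst p" "snd p"] norm_snd_le[of "snd p" "fst p"] by auto
      then have "norm (kern (fst p) (snd p) (Complex 1 t)) \<le>
          fact M * exp (1 + 1 / 1 - snd p * 1 + 1\<^sup>2 / 2) * gauss t"
        by (intro norm_kern_le) auto
      also have "\<dots> \<le> fact M * exp (5/2 + real M) * gauss t"
        using \<open>\<bar>snd p\<bar> \<le> real M\<close> by (intro mult_right_mono mult_left_mono) (auto simp: gauss_def)
      finally show "norm (kern (fst p) (snd p) (Complex 1 t)) \<le> fact M * exp (5/2 + real M) * gauss t" .
    next
      fix t
      have "Complex 1 t \<noteq> 0" by (simp add: complex_eq_iff)
      then show "continuous_on (ball 0 r) (\<lambda>p. kern (fst p) (snd p) (Complex 1 t))"
        unfolding kern_def powr_def by (auto intro!: continuous_intros)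
    qed (use integrable_gauss integrable_kern[of 1] in auto)
  qed
  then have "continuous_on (\<Union>r. ball 0 r) (\<lambda>p. cyl_line 1 (fst p) (snd p))"
    by (intro continuous_on_open_UN) auto
  moreover have "(\<Union>r. ball 0 r) = (UNIV :: (real \<times> real) set)"
    by (auto intro: gt_ex)
  ultimately show ?thesis
    by (auto simp: cyl_def case_prod_beta intro!: continuous_intros)
qed

lemma continuous_on_cyl [continuous_intros]:
  assumes "continuous_on S f" "continuous_on S g"
  shows "continuous_on S (\<lambda>x. cyl (f x) (g x))"
  using continuous_on_compose2[OF continuous_on_cyl_pair continuous_on_Pair[OF assms]] by simp

text \<open>The line through the saddle point, shifted to stay in the right half plane, gives the
  Gaussian decay.\<close>
lemma cyl_bound:
  obtains C where "C > 0" "\<And>\<nu> z. \<bar>\<nu>\<bar> \<le> real M \<Longrightarrow> z \<ge> a \<Longrightarrow> \<bar>cyl \<nu> z\<bar> \<le> C * exp (z - z\<^sup>2 / 2)"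
proof
  define k where "k = 1 + \<bar>a\<bar>"
  define G where "G = integral\<^sup>L lborel gauss"
  show "fact M * exp (k + 1 + k\<^sup>2 / 2) * (G + 1) > 0"
  proof -
    have "G \<ge> 0" unfolding G_def by (intro integral_nonneg_AE) (auto simp: gauss_def)
    then show ?thesis by auto
  qed
  fix \<nu> z :: real assume \<nu>: "\<bar>\<nu>\<bar> \<le> real M" and z: "z \<ge> a"
  define c where "c = z + k"
  have c: "c \<ge> 1" using z by (simp add: c_def k_def)
  have "\<bar>cyl \<nu> z\<bar> = norm (cyl_line c \<nu> z)"
    using c by (simp add: cyl_line_eq_cyl)
  also have "\<dots> \<le> (\<integral>t. fact M * exp (c + 1 / c - z * c + c\<^sup>2 / 2) * gauss t \<partial>lborel)"
    unfolding cyl_line_def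
    using c \<nu> integrable_gauss
    by (intro order_trans[OF integral_norm_bound] integral_mono integrable_norm integrable_kern norm_kern_le
        integrable_mult_right) auto
  also have "\<dots> = fact M * exp (c + 1 / c - z * c + c\<^sup>2 / 2) * G"
    by (simp add: G_def)
  also have "\<dots> \<le> fact M * exp (k + 1 + k\<^sup>2 / 2 + (z - z\<^sup>2 / 2)) * (G + 1)"
  proof -
    \<comment> \<open>For c = z + k the quadratic part -z c + c^2/2 is exactly k^2/2 - z^2/2, and c
      \<ge> 1 gives 1/c \<le> 1.\<close>
    have "c + 1 / c - z * c + c\<^sup>2 / 2 \<le> k + 1 + k\<^sup>2 / 2 + (z - z\<^sup>2 / 2)"
      using c by (simp add: c_def power2_eq_square field_simps)
    then show ?thesis
      unfolding G_def by (intro mult_mono) (auto simp: gauss_def intro!: integral_nonneg_AE)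
  qed
  finally show "\<bar>cyl \<nu> z\<bar> \<le> fact M * exp (k + 1 + k\<^sup>2 / 2) * (G + 1) * exp (z - z\<^sup>2 / 2)"
    by (simp only: exp_add mult_ac)
qed

lemma cyl_exp_tendsto_0: "((\<lambda>z. exp (z\<^sup>2 / 4) * cyl \<nu> z) \<longlongrightarrow> 0) at_top"
proof -
  obtain M :: nat where M: "\<bar>\<nu>\<bar> \<le> real M" using real_arch_simple by blast
  obtain C where C: "\<And>\<nu> z. \<bar>\<nu>\<bar> \<le> real M \<Longrightarrow> z \<ge> 0 \<Longrightarrow> \<bar>cyl \<nu> z\<bar> \<le> C * exp (z - z\<^sup>2 / 2)"
    using cyl_bound[of M 0] by metis
  show ?thesis
  proof (rule Lim_null_comparison)
    show "((\<lambda>z. exp (z\<^sup>2 / 4) * (C * exp (z - z\<^sup>2 / 2))) \<longlongrightarrow> 0) at_top"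
      by real_asymp
    show "\<forall>\<^sub>F z in at_top. norm (exp (z\<^sup>2 / 4) * cyl \<nu> z) \<le> exp (z\<^sup>2 / 4) * (C * exp (z - z\<^sup>2 / 2))"
      using eventually_ge_at_top[of 0]
      by eventually_elim (auto simp: abs_mult intro!: C M)
  qed
qed

lemma cyl_tendsto_0: "(cyl \<nu> \<longlongrightarrow> 0) at_top"
proof -
  have "((\<lambda>z. exp (- (z\<^sup>2 / 4)) * (exp (z\<^sup>2 / 4) * cyl \<nu> z)) \<longlongrightarrow> 0 * 0) at_top"
    by (intro tendsto_mult cyl_exp_tendsto_0) real_asymp
  then show ?thesis by (simp add: mult.assoc[symmetric] flip: exp_add)
qed

section \<open>Positivity for small indices and the first zero in the index\<close>

lemma integral_lborel_pos:
  fixes f :: "real \<Rightarrow> real"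
  assumes "integrable lborel f" "\<And>x. f x \<ge> 0" "a < b" "\<And>x. x \<in> {a<..<b} \<Longrightarrow> f x > 0"
  shows "integral\<^sup>L lborel f > 0"
proof (rule ccontr)
  assume "\<not> ?thesis"
  moreover have "integral\<^sup>L lborel f \<ge> 0" using assms(2) by (intro integral_nonneg_AE) auto
  ultimately have "AE x in lborel. f x = 0"
    using integral_nonneg_eq_0_iff_AE[OF assms(1)] assms(2) by auto
  then have "AE x in lborel. x \<notin> {a<..<b}"
    by eventually_elim (use assms(4) in force)
  then have "{a<..<b} \<in> null_sets lborel"
    by (subst (asm) AE_iff_null_sets[symmetric]) auto
  then show False using \<open>a < b\<close> by (simp add: null_sets_def)
qed

text \<open>On the line Re u = z through the saddle point of -z u + u^2/2 the exponential is the
  positive number exp (-(z^2 + t^2)/2). The real part of the integrand then has the sign of cos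
  (\<nu> arg u), where |arg u| < pi/2 and |\<nu>| \<le> 1.\<close>

lemma cyl_pos_right:
  assumes z: "z > 0" and \<nu>: "\<bar>\<nu>\<bar> \<le> 1"
  shows "cyl \<nu> z > 0"
proof -
  have "Re (kern \<nu> z (Complex z t)) > 0" for t
  proof -
    let ?u = "Complex z t"
    have e: "exp (- (of_real z * ?u)) * exp (?u\<^sup>2 / 2) = of_real (exp (- (z\<^sup>2 + t\<^sup>2) / 2))"
      unfolding exp_of_real[symmetric] exp_add[symmetric]
      by (rule arg_cong[of _ _ exp]) (simp add: complex_eq_iff power2_eq_square field_simps)
    have u: "?u \<noteq> 0" using z by (simp add: complex_eq_iff)
    have "\<bar>Im (Ln ?u)\<bar> < pi / 2" using Re_Ln_pos_lt[OF u] z by simp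
    then have "\<bar>\<nu> * Im (Ln ?u)\<bar> < pi / 2"
      using mult_right_mono[OF \<nu>, of "\<bar>Im (Ln ?u)\<bar>"] by (simp add: abs_mult)
    then have "cos (\<nu> * Im (Ln ?u)) > 0" by (intro cos_gt_zero_pi) auto
    then have "Re (?u powr of_real \<nu>) > 0" using u by (simp add: powr_def Re_exp)
    then show ?thesis by (simp add: kern_def mult.assoc e)
  qed
  then have "0 < (\<integral>t. Re (kern \<nu> z (Complex z t)) \<partial>lborel)"
    using integrable_kern[OF z, of \<nu> z]
    by (intro integral_lborel_pos[of _ 0 1]) (auto intro: less_imp_le)
  also have "\<dots> = Re (cyl_line z \<nu> z)"
    unfolding cyl_line_def using integrable_kern[OF z, of \<nu> z] by simp
  finally show ?thesis using cyl_line_eq_cyl[OF z] by simp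
qed

text \<open>Otherwise let s be the last point at which \<open>cyl \<nu>\<close> is not positive. To
  its right \<open>cyl (\<nu> - 1)\<close> decreases, with limit 0, hence is nonnegative. By the
  recurrence exp (x^2/2) \<open>cyl \<nu> x\<close> has derivative \<nu> exp (x^2/2)
  \<open>cyl (\<nu> - 1) x\<close> \<le> 0 there, so it could not become positive after s.\<close>

lemma cyl_pos:
  assumes \<nu>: "-1 \<le> \<nu>" "\<nu> \<le> 0"
  shows "cyl \<nu> z > 0"
proof (rule ccontr)
  assume "\<not> cyl \<nu> z > 0"
  define S where "S = {z. cyl \<nu> z \<le> 0}"
  define s where "s = Sup S"
  have "z \<in> S" using \<open>\<not> cyl \<nu> z > 0\<close> by (simp add: S_def)
  have bdd: "bdd_above S"
  proof (rule bdd_aboveI[of _ 0])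
    fix x assume "x \<in> S" then show "x \<le> 0"
      using cyl_pos_right[of x \<nu>] \<nu> by (cases "x > 0") (auto simp: S_def)
  qed
  have "closed S"
    unfolding S_def by (intro closed_Collect_le continuous_intros)
  then have "s \<in> S" unfolding s_def using \<open>z \<in> S\<close> bdd by (intro closed_contains_Sup) auto
  have pos: "cyl \<nu> x > 0" if "x > s" for x
    using that cSup_upper[OF _ bdd, of x] by (cases "x \<in> S") (auto simp: S_def s_def)
  have low: "cyl (\<nu> - 1) x \<ge> 0" if x: "x \<ge> s" for x
  proof (rule tendsto_upperbound[OF cyl_tendsto_0])
    show "\<forall>\<^sub>F y in at_top. cyl (\<nu> - 1) y \<le> cyl (\<nu> - 1) x"
      using eventually_ge_at_top[of x]
    proof eventually_elim
      case (elim y)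
      show ?case
      proof (rule DERIV_nonpos_imp_decreasing_open[OF elim])
        fix t assume "x < t" "t < y"
        then show "\<exists>d. ((\<lambda>x. cyl (\<nu> - 1) x) has_real_derivative d) (at t) \<and> d \<le> 0"
          using DERIV_cyl[OF DERIV_ident, of "\<nu> - 1" t] pos[of t] x by force
      qed (intro continuous_intros)
    qed
  qed auto
  have "exp ((s + 1)\<^sup>2 / 2) * cyl \<nu> (s + 1) \<le> exp (s\<^sup>2 / 2) * cyl \<nu> s"
  proof (rule DERIV_nonpos_imp_nonincreasing[where f = "\<lambda>x. exp (x\<^sup>2 / 2) * cyl \<nu> x"])
    fix x assume x: "s \<le> x" "x \<le> s + 1"
    have "((\<lambda>x. exp (x\<^sup>2 / 2) * cyl \<nu> x) has_real_derivative exp (x\<^sup>2 / 2) * (x * cyl \<nu> x - cyl (\<nu> + 1) x)) (at x)"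
      by (auto intro!: derivative_eq_intros simp: algebra_simps)
    moreover have "exp (x\<^sup>2 / 2) * (x * cyl \<nu> x - cyl (\<nu> + 1) x) \<le> 0"
      unfolding cyl_recurrence[symmetric] by (rule mult_nonneg_nonpos[OF _ mult_nonpos_nonneg[OF \<nu>(2) low[OF x(1)]]]) simp
    ultimately show "\<exists>d. ((\<lambda>x. exp (x\<^sup>2 / 2) * cyl \<nu> x) has_real_derivative d) (at x) \<and> d \<le> 0"
      by blast
  qed simp
  moreover have "exp (s\<^sup>2 / 2) * cyl \<nu> s \<le> 0"
    using \<open>s \<in> S\<close> by (auto simp: S_def mult_nonneg_nonpos)
  ultimately have "exp ((s + 1)\<^sup>2 / 2) * cyl \<nu> (s + 1) \<le> 0" by linarith
  with pos[of "s + 1"] show False by (simp add: mult_le_0_iff)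
qed

text \<open>Two consecutive zeros propagate downwards in the index through the recurrence, as long
  as \<nu> > 0, until they reach [-1, 0], where \<open>cyl\<close> is positive.\<close>

lemma cyl_not_both_zero:
  assumes "\<nu> \<ge> -1" "cyl \<nu> z = 0"
  shows "cyl (\<nu> + 1) z \<noteq> 0"
proof -
  have "\<nu> \<ge> -1 \<Longrightarrow> \<nu> \<le> real n \<Longrightarrow> cyl \<nu> z = 0 \<Longrightarrow> cyl (\<nu> + 1) z \<noteq> 0" for n
  proof (induction n arbitrary: \<nu>)
    case 0
    then show ?case using cyl_pos[of \<nu> z] by auto
  next
    case (Suc n)
    show ?case
    proof (cases "\<nu> \<le> 0")
      case True
      then show ?thesis using Suc.prems cyl_pos[of \<nu> z] by auto
    next
      case False
      then show ?thesis
        using Suc.prems Suc.IH[of "\<nu> - 1"] cyl_recurrence[of \<nu> z] by auto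
    qed
  qed
  moreover obtain n :: nat where "\<nu> \<le> real n" using real_arch_simple by blast
  ultimately show ?thesis using assms by simp
qed

text \<open>If all values were positive, the recurrence would give
  \<open>n * cyl (n - 1) < z * cyl n < z\<^sup>2 * cyl (n - 1)\<close> for every \<open>n \<ge> 2\<close>.\<close>
lemma ex_cyl_nonpos: "\<exists>\<nu>\<ge>0. cyl \<nu> z \<le> 0"
proof (rule ccontr)
  assume "\<not> ?thesis"
  then have pos: "cyl \<nu> z > 0" if "\<nu> \<ge> 0" for \<nu> using that by force
  obtain n :: nat where n: "z\<^sup>2 + 2 \<le> real n" using real_arch_simple by blast
  then have n2: "real n \<ge> 2" using zero_le_power2[of z] by linarith
  have "real n * cyl (real n - 1) z < z * cyl (real n) z"
    using cyl_recurrence[of "real n" z] pos[of "real n + 1"] by simp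
  moreover from this have "z > 0"
    using pos[of "real n - 1"] pos[of "real n"] n2 zero_less_mult_pos2[of z "cyl (real n) z"]
      mult_pos_pos[of "real n" "cyl (real n - 1) z"] by linarith
  moreover have "cyl (real n) z < z * cyl (real n - 1) z"
    using cyl_recurrence[of "real n - 1" z] pos[of "real n - 1 - 1"] n2
      mult_pos_pos[of "real n - 1" "cyl (real n - 1 - 1) z"] by simp
  ultimately have "real n * cyl (real n - 1) z < z * (z * cyl (real n - 1) z)"
    using mult_strict_left_mono[of "cyl (real n) z" "z * cyl (real n - 1) z" z] by linarith
  then have "(real n - z\<^sup>2) * cyl (real n - 1) z < 0"
    by (simp add: algebra_simps power2_eq_square)
  moreover have "(real n - z\<^sup>2) * cyl (real n - 1) z \<ge> 0"
    using n n2 pos[of "real n - 1"] by (intro mult_nonneg_nonneg) auto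
  ultimately show False by linarith
qed

text \<open>The infimum \<mu> of the indices \<ge> 0 with a nonpositive value is attained, and the
  limit from the left gives the value 0 there. Positivity is recorded from -1 on because the
  matching condition involves index \<nu> - 1 with \<nu> \<ge> 0.\<close>

lemma first_cyl_zero:
  obtains \<mu> where "\<mu> > 0" "cyl \<mu> z = 0" "\<And>\<nu>. -1 \<le> \<nu> \<Longrightarrow> \<nu> < \<mu> \<Longrightarrow> cyl \<nu> z > 0"
proof -
  define S where "S = {\<nu>. cyl \<nu> z \<le> 0} \<inter> {0..}"
  have S: "closed S" "S \<noteq> {}" "bdd_below S"
    unfolding S_def using ex_cyl_nonpos[of z]
    by (auto intro!: closed_Int closed_Collect_le continuous_intros)
  define \<mu> where "\<mu> = Inf S"
  have \<mu>: "\<mu> \<in> S" unfolding \<mu>_def using S by (intro closed_contains_Inf)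
  then have "\<mu> \<noteq> 0" using cyl_pos[of 0 z] by (auto simp: S_def)
  then have "\<mu> > 0" using \<mu> by (simp add: S_def)
  have below: "cyl \<nu> z > 0" if "-1 \<le> \<nu>" "\<nu> < \<mu>" for \<nu>
    using that cInf_lower[OF _ S(3), of \<nu>] cyl_pos[of \<nu> z]
    by (cases "\<nu> \<le> 0"; cases "\<nu> \<in> S") (auto simp: S_def \<mu>_def)
  have "continuous_on UNIV (\<lambda>\<nu>. cyl \<nu> z)" by (intro continuous_intros)
  then have "((\<lambda>\<nu>. cyl \<nu> z) \<longlongrightarrow> cyl \<mu> z) (at_left \<mu>)"
    by (auto simp: continuous_on_def intro: tendsto_within_subset)
  moreover have "\<forall>\<^sub>F \<nu> in at_left \<mu>. 0 \<le> cyl \<nu> z"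
    using eventually_at_left_real[OF \<open>\<mu> > 0\<close>] by eventually_elim (auto intro!: less_imp_le below)
  ultimately have "cyl \<mu> z \<ge> 0" by (intro tendsto_lowerbound) auto
  with \<mu> have "cyl \<mu> z = 0" by (auto simp: S_def)
  with \<open>\<mu> > 0\<close> below show ?thesis by (intro that)
qed

section \<open>Sign change at the first zero in the index\<close>

text \<open>\<open>cyl \<nu>\<close> solves y'' + z y' + (\<nu> + 1) y = 0, and exp (z^2/2) is the
  factor making this equation self-adjoint. The bracket is minus the Wronskian of the two
  solutions.\<close>

lemma DERIV_cyl_wronskian:
  "((\<lambda>z. exp (z\<^sup>2 / 2) * (cyl (\<nu> + 1) z * cyl \<mu> z - cyl \<nu> z * cyl (\<mu> + 1) z)) has_real_derivative
     (\<nu> - \<mu>) * (exp (z\<^sup>2 / 2) * cyl \<nu> z * cyl \<mu> z)) (at z)"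
proof -
  have r: "cyl (\<nu> + 1 + 1) z = z * cyl (\<nu> + 1) z - (\<nu> + 1) * cyl \<nu> z" for \<nu>
    using cyl_recurrence[of "\<nu> + 1" z] by simp
  have "((\<lambda>z. exp (z\<^sup>2 / 2) * (cyl (\<nu> + 1) z * cyl \<mu> z - cyl \<nu> z * cyl (\<mu> + 1) z)) has_real_derivative
      z * exp (z\<^sup>2 / 2) * (cyl (\<nu> + 1) z * cyl \<mu> z - cyl \<nu> z * cyl (\<mu> + 1) z) +
      exp (z\<^sup>2 / 2) * ((- cyl (\<nu> + 1 + 1) z * cyl \<mu> z + cyl (\<nu> + 1) z * - cyl (\<mu> + 1) z)
        - (- cyl (\<nu> + 1) z * cyl (\<mu> + 1) z + cyl \<nu> z * - cyl (\<mu> + 1 + 1) z))) (at z)"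
    by (rule derivative_eq_intros refl | simp)+
  then show ?thesis
    by (rule DERIV_cong) (simp only: r, simp add: algebra_simps)
qed

lemma cyl_product_bound:
  obtains C where "C > 0" "\<And>\<nu> \<mu> z. \<bar>\<nu>\<bar> \<le> real M \<Longrightarrow> \<bar>\<mu>\<bar> \<le> real M \<Longrightarrow> z \<ge> a \<Longrightarrow>
    \<bar>exp (z\<^sup>2 / 2) * cyl \<nu> z * cyl \<mu> z\<bar> \<le> C * gauss z"
proof -
  obtain C where C: "C > 0" "\<And>\<nu> z. \<bar>\<nu>\<bar> \<le> real M \<Longrightarrow> z \<ge> a \<Longrightarrow> \<bar>cyl \<nu> z\<bar> \<le> C * exp (z - z\<^sup>2 / 2)"
    using cyl_bound[of M a] by metis
  show ?thesis
  proof (rule that[of "C\<^sup>2 * exp 3"])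
    show "C\<^sup>2 * exp 3 > 0" using C by simp
  next
    fix \<nu> \<mu> z assume *: "\<bar>\<nu>\<bar> \<le> real M" "\<bar>\<mu>\<bar> \<le> real M" "z \<ge> a"
    have "\<bar>exp (z\<^sup>2 / 2) * cyl \<nu> z * cyl \<mu> z\<bar> = exp (z\<^sup>2 / 2) * (\<bar>cyl \<nu> z\<bar> * \<bar>cyl \<mu> z\<bar>)"
      by (simp add: abs_mult)
    also have "\<dots> \<le> exp (z\<^sup>2 / 2) * ((C * exp (z - z\<^sup>2 / 2)) * (C * exp (z - z\<^sup>2 / 2)))"
      using C * by (intro mult_left_mono mult_mono) auto
    also have "\<dots> = C\<^sup>2 * exp (z\<^sup>2 / 2 + (z - z\<^sup>2 / 2) + (z - z\<^sup>2 / 2))"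
      by (simp only: exp_add power2_eq_square mult_ac)
    \<comment> \<open>The exponent is 2 z - z^2/2, and (z/2 - 2)^2 \<ge> 0 gives 2 z \<le> 4 +
      z^2/4; the 4 is split as 3 + 1 to match \<open>gauss\<close>.\<close>
    also have "\<dots> \<le> C\<^sup>2 * exp (3 + (1 - z\<^sup>2 / 4))"
      using zero_le_power2[of "z / 2 - 2"]
      by (intro mult_left_mono) (auto simp: power2_eq_square field_simps)
    also have "\<dots> = C\<^sup>2 * exp 3 * gauss z"
      by (simp only: exp_add gauss_def mult.assoc)
    finally show "\<bar>exp (z\<^sup>2 / 2) * cyl \<nu> z * cyl \<mu> z\<bar> \<le> C\<^sup>2 * exp 3 * gauss z" .
  qed
qed

lemma cyl_product_integrable:
  "integrable lborel (\<lambda>z. indicator {a<..} z * (exp (z\<^sup>2 / 2) * cyl \<nu> z * cyl \<mu> z))"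
proof -
  obtain M :: nat where M: "max \<bar>\<nu>\<bar> \<bar>\<mu>\<bar> \<le> real M" using real_arch_simple by blast
  obtain C where C: "C > 0" "\<And>\<nu> \<mu> z. \<bar>\<nu>\<bar> \<le> real M \<Longrightarrow> \<bar>\<mu>\<bar> \<le> real M \<Longrightarrow> z \<ge> a \<Longrightarrow>
    \<bar>exp (z\<^sup>2 / 2) * cyl \<nu> z * cyl \<mu> z\<bar> \<le> C * gauss z"
    using cyl_product_bound[of M a] by metis
  show ?thesis
  proof (rule Bochner_Integration.integrable_bound)
    show "integrable lborel (\<lambda>z. C * gauss z)" using integrable_gauss by simp
    have "(\<lambda>z. exp (z\<^sup>2 / 2) * cyl \<nu> z * cyl \<mu> z) \<in> borel_measurable borel"
      by (intro borel_measurable_continuous_onI continuous_intros) auto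
    then show "(\<lambda>z. indicator {a<..} z * (exp (z\<^sup>2 / 2) * cyl \<nu> z * cyl \<mu> z)) \<in> borel_measurable lborel"
      by simp
    show "AE z in lborel. norm (indicator {a<..} z * (exp (z\<^sup>2 / 2) * cyl \<nu> z * cyl \<mu> z)) \<le> norm (C * gauss z)"
    proof (rule AE_I2)
      fix z
      show "norm (indicator {a<..} z * (exp (z\<^sup>2 / 2) * cyl \<nu> z * cyl \<mu> z)) \<le> norm (C * gauss z)"
        using C(2)[of \<nu> \<mu> z] M abs_ge_self[of "C * gauss z"]
        by (cases "z > a") (auto simp del: abs_mult simp: indicator_def)
    qed
  qed
qed

text \<open>At infinity exp (z^2/2) splits into two factors exp (z^2/4), each absorbed by the decay
  of one \<open>cyl\<close>. At the lower end \<open>a\<close> the zero of \<open>cyl \<mu>\<close>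
  leaves only one of the two products.\<close>

lemma cyl_wronskian_integral:
  assumes "cyl \<mu> a = 0"
  shows "exp (a\<^sup>2 / 2) * cyl \<nu> a * cyl (\<mu> + 1) a =
     (\<nu> - \<mu>) * (\<integral>z. indicator {a<..} z * (exp (z\<^sup>2 / 2) * cyl \<nu> z * cyl \<mu> z) \<partial>lborel)"
proof -
  let ?W = "\<lambda>z. exp (z\<^sup>2 / 2) * (cyl (\<nu> + 1) z * cyl \<mu> z - cyl \<nu> z * cyl (\<mu> + 1) z)"
  let ?f = "\<lambda>z. (\<nu> - \<mu>) * (exp (z\<^sup>2 / 2) * cyl \<nu> z * cyl \<mu> z)"
  have e: "einterval (ereal a) \<infinity> = {a<..}" by (auto simp: einterval_def)
  have "((\<lambda>z. (exp (z\<^sup>2 / 4) * cyl (\<nu> + 1) z) * (exp (z\<^sup>2 / 4) * cyl \<mu> z)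
      - (exp (z\<^sup>2 / 4) * cyl \<nu> z) * (exp (z\<^sup>2 / 4) * cyl (\<mu> + 1) z)) \<longlongrightarrow> 0 * 0 - 0 * 0) at_top"
    by (intro tendsto_intros cyl_exp_tendsto_0)
  moreover have "(exp (z\<^sup>2 / 4) * cyl (\<nu> + 1) z) * (exp (z\<^sup>2 / 4) * cyl \<mu> z)
      - (exp (z\<^sup>2 / 4) * cyl \<nu> z) * (exp (z\<^sup>2 / 4) * cyl (\<mu> + 1) z) = ?W z" for z
  proof -
    have "exp (z\<^sup>2 / 2) = exp (z\<^sup>2 / 4) * exp (z\<^sup>2 / 4)" by (simp flip: exp_add)
    then show ?thesis by (simp add: algebra_simps)
  qed
  ultimately have lim: "(?W \<longlongrightarrow> 0) at_top" by simp
  have "(LBINT z=a..\<infinity>. ?f z) = 0 - ?W a"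
  proof (rule interval_integral_FTC_integrable[where F = ?W])
    show "(?W has_vector_derivative ?f x) (at x)" for x
      using DERIV_cyl_wronskian by (simp add: has_real_derivative_iff_has_vector_derivative)
    show "isCont ?f x" for x
    proof -
      have "continuous_on UNIV ?f" by (intro continuous_intros) auto
      then show ?thesis by (simp add: continuous_on_eq_continuous_at)
    qed
    show "set_integrable lborel (einterval (ereal a) \<infinity>) ?f"
      using integrable_mult_right[OF cyl_product_integrable, of "\<nu> - \<mu>" a \<nu> \<mu>]
      unfolding e set_integrable_def by (simp add: mult_ac)
    have "continuous_on UNIV ?W" by (intro continuous_intros) auto
    then have "(?W \<longlongrightarrow> ?W a) (at_right a)"
      by (auto simp: continuous_on_def intro: tendsto_within_subset)
    then show "((?W \<circ> real_of_ereal) \<longlongrightarrow> ?W a) (at_right (ereal a))"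
      by (simp add: ereal_tendsto_simps)
    show "((?W \<circ> real_of_ereal) \<longlongrightarrow> 0) (at_left \<infinity>)"
      using lim by (simp add: ereal_tendsto_simps)
  qed simp
  moreover have "(LBINT z=a..\<infinity>. ?f z) =
      (\<nu> - \<mu>) * (\<integral>z. indicator {a<..} z * (exp (z\<^sup>2 / 2) * cyl \<nu> z * cyl \<mu> z) \<partial>lborel)"
    unfolding interval_lebesgue_integral_def e set_lebesgue_integral_def
    using cyl_product_integrable[of a \<nu> \<mu>]
    by (simp add: mult.left_commute[of _ "\<nu> - \<mu>"])
  ultimately show ?thesis using assms by simp
qed

text \<open>As \<nu> tends to \<mu>, the integral in \<open>cyl_wronskian_integral\<close> tends to
  a weighted square norm of \<open>cyl \<mu>\<close>, which is positive. Near \<mu> the product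
  \<open>cyl \<nu> a * cyl (\<mu> + 1) a\<close> therefore has the sign of \<nu> - \<mu>. Positivity
  on the left shows \<open>cyl (\<mu> + 1) a\<close> < 0, and this makes \<open>cyl \<nu> a\<close>
  negative on the right.\<close>

lemma cyl_sign_change:
  assumes \<mu>: "\<mu> > 0" "cyl \<mu> a = 0" and below: "\<And>\<nu>. -1 \<le> \<nu> \<Longrightarrow> \<nu> < \<mu> \<Longrightarrow> cyl \<nu> a > 0"
    and "\<epsilon> > 0"
  obtains \<nu> where "\<mu> < \<nu>" "\<nu> < \<mu> + \<epsilon>" "cyl \<nu> a < 0"
proof -
  define I where "I \<nu> = (\<integral>z. indicator {a<..} z * (exp (z\<^sup>2 / 2) * cyl \<nu> z * cyl \<mu> z) \<partial>lborel)" for \<nu>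
  obtain M :: nat where M: "\<mu> + 1 \<le> real M" using real_arch_simple by blast
  obtain C where C: "C > 0" "\<And>\<nu> \<mu> z. \<bar>\<nu>\<bar> \<le> real M \<Longrightarrow> \<bar>\<mu>\<bar> \<le> real M \<Longrightarrow> z \<ge> a \<Longrightarrow>
    \<bar>exp (z\<^sup>2 / 2) * cyl \<nu> z * cyl \<mu> z\<bar> \<le> C * gauss z"
    using cyl_product_bound[of M a] by metis
  have ne: "cyl (\<mu> + 1) a \<noteq> 0" using cyl_not_both_zero \<mu> by simp
  have "continuous_on {0<..<real M} I"
    unfolding I_def
  proof (rule continuous_on_integral_param[where w = "\<lambda>z. C * gauss z"])
    fix \<nu> z assume "\<nu> \<in> {0<..<real M}"
    then show "norm (indicator {a<..} z * (exp (z\<^sup>2 / 2) * cyl \<nu> z * cyl \<mu> z)) \<le> C * gauss z"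
      using C(2)[of \<nu> \<mu> z] C(1) M \<mu>
      by (cases "z > a") (auto simp del: abs_mult simp: indicator_def gauss_def)
  qed (use integrable_gauss cyl_product_integrable in \<open>auto intro!: continuous_intros\<close>)
  then have "isCont I \<mu>"
    using \<mu> M by (intro continuous_on_interior[of "{0<..<real M}"]) (auto simp: interior_open)
  moreover have "I \<mu> > 0"
  proof -
    have d: "((\<lambda>z. cyl \<mu> z) has_real_derivative - cyl (\<mu> + 1) a * 1) (at a)"
      by (intro DERIV_cyl DERIV_ident)
    \<comment> \<open>The derivative of \<open>cyl \<mu>\<close> at its zero \<open>a\<close> does
      not vanish, so just to the right of \<open>a\<close> the function is nonzero and the squared
      integrand is positive.\<close>
    obtain \<delta> where \<delta>: "\<delta> > 0" "\<And>h. 0 < h \<Longrightarrow> h < \<delta> \<Longrightarrow> cyl \<mu> (a + h) \<noteq> 0"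
    proof (cases "cyl (\<mu> + 1) a < 0")
      case True
      then show ?thesis using DERIV_pos_inc_right[OF d] that \<mu> by force
    next
      case False
      then show ?thesis using DERIV_neg_dec_right[OF d] ne that \<mu> by force
    qed
    show ?thesis
      unfolding I_def
    proof (rule integral_lborel_pos[OF cyl_product_integrable, of _ _ _ a "a + \<delta>"])
      fix z assume "z \<in> {a<..<a + \<delta>}"
      then show "0 < indicator {a<..} z * (exp (z\<^sup>2 / 2) * cyl \<mu> z * cyl \<mu> z)"
        using \<delta>(2)[of "z - a"] by (auto simp: mult.assoc zero_less_mult_iff linorder_neq_iff)
    qed (use \<delta> in \<open>auto simp: mult.assoc\<close>)
  qed
  ultimately have "\<forall>\<^sub>F \<nu> in at \<mu>. I \<nu> > 0"
    unfolding isCont_def by (rule order_tendstoD)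
  then obtain \<delta> where \<delta>: "\<delta> > 0" "\<And>\<nu>. \<nu> \<noteq> \<mu> \<Longrightarrow> dist \<nu> \<mu> < \<delta> \<Longrightarrow> I \<nu> > 0"
    unfolding eventually_at by blast
  \<comment> \<open>Small enough that both \<mu> - h and \<mu> + h lie where \<open>I\<close> is
    positive, that \<mu> - h > 0, and that \<mu> + h < \<mu> + \<epsilon>.\<close>
  define h where "h = min (min \<delta> \<epsilon>) \<mu> / 2"
  have h: "0 < h" "h < \<delta>" "h < \<epsilon>" "h < \<mu>" using \<delta> \<open>\<epsilon> > 0\<close> \<mu> by (auto simp: h_def)
  have eq: "exp (a\<^sup>2 / 2) * cyl \<nu> a * cyl (\<mu> + 1) a = (\<nu> - \<mu>) * I \<nu>" for \<nu>
    unfolding I_def by (rule cyl_wronskian_integral[OF \<mu>(2)])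
  have "exp (a\<^sup>2 / 2) * cyl (\<mu> - h) a * cyl (\<mu> + 1) a < 0"
    unfolding eq using \<delta>(2)[of "\<mu> - h"] h by (intro mult_neg_pos) (auto simp: dist_real_def)
  moreover have "exp (a\<^sup>2 / 2) * cyl (\<mu> - h) a > 0"
    using below[of "\<mu> - h"] h by simp
  ultimately have neg: "cyl (\<mu> + 1) a < 0"
    by (meson mult_nonneg_nonneg less_imp_le not_le)
  have "exp (a\<^sup>2 / 2) * cyl (\<mu> + h) a * cyl (\<mu> + 1) a > 0"
    unfolding eq using \<delta>(2)[of "\<mu> + h"] h by (intro mult_pos_pos) (auto simp: dist_real_def)
  with neg have "cyl (\<mu> + h) a < 0"
    by (metis exp_gt_zero less_asym mult.commute mult_less_cancel_left_disj mult_zero_left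
        zero_less_mult_iff)
  with h show ?thesis by (intro that[of "\<mu> + h"]) auto
qed

section \<open>Solutions on a half line\<close>

text \<open>Membership in L^2 controls neither \<psi> nor \<psi>' pointwise. Averaging W against a
  bump g on [L, L+1] and integrating (\<psi> p g)' moves the derivative off \<psi>: W is the
  integral of 2 \<psi> p' g + \<psi> p g', which is small for large L because p and p' are.\<close>

lemma L2_wronskian_eq_0:
  fixes \<psi> \<psi>' p p' :: "real \<Rightarrow> real"
  assumes d: "\<And>x. x > 0 \<Longrightarrow> (\<psi> has_real_derivative \<psi>' x) (at x)"
      "\<And>x. x > 0 \<Longrightarrow> (p has_real_derivative p' x) (at x)"
    and W: "\<And>x. x > 0 \<Longrightarrow> \<psi> x * p' x - \<psi>' x * p x = W"
    and L2: "integrable lborel (\<lambda>x. (\<psi> x)\<^sup>2)"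
    and lim: "(p \<longlongrightarrow> 0) at_top" "(p' \<longlongrightarrow> 0) at_top"
  shows "W = 0"
proof -
  define J where "J = (\<integral>x. (\<psi> x)\<^sup>2 \<partial>lborel)"
  have "J \<ge> 0" unfolding J_def by (intro integral_nonneg_AE) auto
  have bound: "\<bar>W\<bar> \<le> \<epsilon> * (18 * (1 + J))" if "\<epsilon> > 0" for \<epsilon>
  proof -
    have "\<forall>\<^sub>F x in at_top. dist (p x) 0 < \<epsilon> \<and> dist (p' x) 0 < \<epsilon> \<and> x > 0"
      using tendstoD[OF lim(1) that] tendstoD[OF lim(2) that] eventually_gt_at_top[of 0]
      by eventually_elim auto
    then obtain L where L: "\<And>x. x \<ge> L \<Longrightarrow> \<bar>p x\<bar> < \<epsilon>" "\<And>x. x \<ge> L \<Longrightarrow> \<bar>p' x\<bar> < \<epsilon>" "L > 0"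
      unfolding eventually_at_top_linorder by auto
    \<comment> \<open>With y = x - L this is 6 y (1 - y): zero at both ends, so no boundary terms
      occur, and of integral 1.\<close>
    define g where "g x = 6 * (x - L) * (1 - (x - L))" for x
    define g' where "g' x = 6 - 12 * (x - L)" for x
    define h where "h x = 2 * \<psi> x * p' x * g x + \<psi> x * p x * g' x" for x
    have dg: "(g has_real_derivative g' x) (at x)" for x
      unfolding g_def[abs_def] g'_def by (auto intro!: derivative_eq_intros simp: algebra_simps)
    have i1: "((\<lambda>x. h x - W * g x) has_integral 0) {L..L + 1}"
    proof -
      have "((\<lambda>x. h x - W * g x) has_integral \<psi> (L + 1) * p (L + 1) * g (L + 1) - \<psi> L * p L * g L) {L..L + 1}"
      proof (rule fundamental_theorem_of_calculus)
        fix x assume "x \<in> {L..L + 1}"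
        then have x: "x > 0" using L by auto
        have "((\<lambda>x. \<psi> x * p x * g x) has_real_derivative
            (\<psi>' x * p x + p' x * \<psi> x) * g x + g' x * (\<psi> x * p x)) (at x)"
          by (intro DERIV_mult d x dg)
        moreover have "(\<psi>' x * p x + p' x * \<psi> x) * g x + g' x * (\<psi> x * p x) = h x - W * g x"
          unfolding h_def W[OF x, symmetric] by (simp add: algebra_simps)
        ultimately show "((\<lambda>x. \<psi> x * p x * g x) has_vector_derivative h x - W * g x) (at x within {L..L + 1})"
          by (auto simp: has_real_derivative_iff_has_vector_derivative intro: has_vector_derivative_at_within)
      qed simp
      then show ?thesis by (simp add: g_def)
    qed
    have i2: "((\<lambda>x. W * g x) has_integral W) {L..L + 1}"
    proof -
      have "((\<lambda>x. W * g x) has_integral W * (3 * (L + 1 - L)\<^sup>2 - 2 * (L + 1 - L) ^ 3)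
          - W * (3 * (L - L)\<^sup>2 - 2 * (L - L) ^ 3)) {L..L + 1}"
      proof (rule fundamental_theorem_of_calculus)
        fix x
        have "((\<lambda>x. W * (3 * (x - L)\<^sup>2 - 2 * (x - L) ^ 3)) has_real_derivative W * g x) (at x)"
          unfolding g_def
          by (auto intro!: derivative_eq_intros simp: algebra_simps power2_eq_square)
        then show "((\<lambda>x. W * (3 * (x - L)\<^sup>2 - 2 * (x - L) ^ 3)) has_vector_derivative W * g x) (at x within {L..L + 1})"
          by (auto simp: has_real_derivative_iff_has_vector_derivative intro: has_vector_derivative_at_within)
      qed simp
      then show ?thesis by simp
    qed
    have i3: "(h has_integral W) {L..L + 1}"
      using has_integral_add[OF i1 i2] by simp
    have s: "set_integrable lborel {L..L + 1} (\<lambda>x. (\<psi> x)\<^sup>2)"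
      unfolding set_integrable_def by (rule integrable_mult_indicator[OF _ L2]) simp
    \<comment> \<open>Majorant of |h|: since |p|, |p'| < \<epsilon> and |g|, |g'| \<le> 6, it is at
      most (2 * 6 + 6) \<epsilon> |\<psi>|, and |\<psi>| \<le> 1 + \<psi>^2 brings in the L^2
      norm.\<close>
    have "((\<lambda>x. 18 * \<epsilon> * (1 + (\<psi> x)\<^sup>2)) has_integral
        18 * \<epsilon> * (1 + integral {L..L + 1} (\<lambda>x. (\<psi> x)\<^sup>2))) {L..L + 1}"
      using set_borel_integral_eq_integral(1)[OF s] has_integral_const_real[of "1::real" L "L + 1"]
      by (intro has_integral_mult_right has_integral_add) auto
    then have "norm (integral {L..L + 1} h) \<le> integral {L..L + 1} (\<lambda>x. 18 * \<epsilon> * (1 + (\<psi> x)\<^sup>2))"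
    proof (intro integral_norm_bound_integral)
      fix x assume x: "x \<in> {L..L + 1}"
      have "\<bar>x - L\<bar> * \<bar>1 - (x - L)\<bar> \<le> 1 * 1" using x by (intro mult_mono) auto
      moreover have "\<bar>g x\<bar> = 6 * (\<bar>x - L\<bar> * \<bar>1 - (x - L)\<bar>)"
        by (simp only: g_def abs_mult abs_numeral mult.assoc)
      ultimately have g: "\<bar>g x\<bar> \<le> 6" by linarith
      have g': "\<bar>g' x\<bar> \<le> 6" using x by (auto simp: g'_def)
      have "\<bar>\<psi> x\<bar> \<le> 1 + (\<psi> x)\<^sup>2"
        using zero_le_power2[of "\<bar>\<psi> x\<bar> - 1"] by (simp add: power2_diff)
      have "norm (h x) \<le> 2 * \<bar>\<psi> x\<bar> * \<bar>p' x\<bar> * \<bar>g x\<bar> + \<bar>\<psi> x\<bar> * \<bar>p x\<bar> * \<bar>g' x\<bar>"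
        unfolding h_def real_norm_def by (rule order_trans[OF abs_triangle_ineq]) (simp add: abs_mult)
      also have "\<dots> \<le> 2 * \<bar>\<psi> x\<bar> * \<epsilon> * 6 + \<bar>\<psi> x\<bar> * \<epsilon> * 6"
        using L(1)[of x] L(2)[of x] x g g' that by (intro add_mono mult_mono) auto
      also have "\<dots> = 18 * \<epsilon> * \<bar>\<psi> x\<bar>" by simp
      also have "\<dots> \<le> 18 * \<epsilon> * (1 + (\<psi> x)\<^sup>2)"
        using that \<open>\<bar>\<psi> x\<bar> \<le> 1 + (\<psi> x)\<^sup>2\<close> by (intro mult_left_mono) auto
      finally show "norm (h x) \<le> 18 * \<epsilon> * (1 + (\<psi> x)\<^sup>2)" .
    qed (use i3 in \<open>auto simp: has_integral_iff\<close>)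
    moreover have "integral {L..L + 1} h = W" using i3 by (rule integral_unique)
    moreover have "integral {L..L + 1} (\<lambda>x. 18 * \<epsilon> * (1 + (\<psi> x)\<^sup>2)) =
        18 * \<epsilon> * (1 + integral {L..L + 1} (\<lambda>x. (\<psi> x)\<^sup>2))"
      using \<open>((\<lambda>x. 18 * \<epsilon> * (1 + (\<psi> x)\<^sup>2)) has_integral _) _\<close> by (rule integral_unique)
    moreover have "integral {L..L + 1} (\<lambda>x. (\<psi> x)\<^sup>2) \<le> J"
      unfolding set_borel_integral_eq_integral(2)[OF s, symmetric] J_def set_lebesgue_integral_def
      using s L2 unfolding set_integrable_def by (intro integral_mono) (auto simp: indicator_def)
    ultimately have "\<bar>W\<bar> \<le> 18 * \<epsilon> * (1 + integral {L..L + 1} (\<lambda>x. (\<psi> x)\<^sup>2))"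
      by (simp only: real_norm_def)
    also have "\<dots> \<le> 18 * \<epsilon> * (1 + J)"
      using that \<open>integral {L..L + 1} (\<lambda>x. (\<psi> x)\<^sup>2) \<le> J\<close> by (intro mult_left_mono) auto
    finally show ?thesis by (simp add: mult_ac)
  qed
  show ?thesis
  proof (rule ccontr)
    assume "W \<noteq> 0"
    define K where "K = 18 * (1 + J)"
    have "K > 0" using \<open>J \<ge> 0\<close> by (simp add: K_def)
    have "\<bar>W\<bar> / (2 * K) > 0" using \<open>W \<noteq> 0\<close> \<open>K > 0\<close> by simp
    from bound[OF this] have "\<bar>W\<bar> \<le> \<bar>W\<bar> / (2 * K) * K" by (simp only: K_def)
    also have "\<dots> = \<bar>W\<bar> / 2" using \<open>K > 0\<close> by simp
    finally show False using \<open>W \<noteq> 0\<close> by simp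
  qed
qed

text \<open>The Wronskian is constant on x > 0 and, by continuity, up to x = 0. The equations are
  assumed only for x > 0 because the potential may jump at the interface.\<close>

lemma half_line_wronskian_eq_0:
  fixes \<psi> \<psi>' p p' q :: "real \<Rightarrow> real"
  assumes cont: "continuous_on {0..} \<psi>" "continuous_on {0..} \<psi>'" "continuous_on {0..} p" "continuous_on {0..} p'"
    and d: "\<And>x. x > 0 \<Longrightarrow> (\<psi> has_real_derivative \<psi>' x) (at x)"
      "\<And>x. x > 0 \<Longrightarrow> (\<psi>' has_real_derivative q x * \<psi> x) (at x)"
      "\<And>x. x > 0 \<Longrightarrow> (p has_real_derivative p' x) (at x)"
      "\<And>x. x > 0 \<Longrightarrow> (p' has_real_derivative q x * p x) (at x)"
    and L2: "integrable lborel (\<lambda>x. (\<psi> x)\<^sup>2)"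
    and lim: "(p \<longlongrightarrow> 0) at_top" "(p' \<longlongrightarrow> 0) at_top"
  shows "\<psi> 0 * p' 0 = \<psi>' 0 * p 0"
proof -
  define w where "w x = \<psi> x * p' x - \<psi>' x * p x" for x
  have w: "w x = w 0" if "x \<ge> 0" for x
  proof (cases "x = 0")
    case False
    show ?thesis
    proof (rule DERIV_isconst2[of 0 x w x])
      show "continuous_on {0..x} w"
        unfolding w_def using cont
        by (auto intro!: continuous_intros intro: continuous_on_subset)
      show "(w has_real_derivative 0) (at y)" if "0 < y" "y < x" for y
        unfolding w_def[abs_def]
        by (rule DERIV_cong[OF DERIV_diff[OF DERIV_mult DERIV_mult]], (rule d that)+) simp
    qed (use that False in auto)
  qed simp
  have "w 0 = 0"
  proof (rule L2_wronskian_eq_0[of \<psi> \<psi>' p p', OF d(1) d(3) _ L2 lim])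
    fix x :: real assume "x > 0"
    then have "w x = w 0" by (intro w) simp
    then show "\<psi> x * p' x - \<psi>' x * p x = w 0" by (simp only: w_def[of x])
  qed
  then show ?thesis by (simp add: w_def)
qed

text \<open>Gronwall's argument: (y^2 + y'^2)' = 2 y y' (1 + q) \<le> (1 + M) (y^2 + y'^2) with M a
  bound of |q|, so the energy times exp (-(1 + M) t) cannot grow from 0.\<close>

lemma linear_ode_unique:
  fixes y y' q :: "real \<Rightarrow> real"
  assumes cont: "continuous_on {0..} y" "continuous_on {0..} y'" "continuous_on {0..} q"
    and d: "\<And>x. x > 0 \<Longrightarrow> (y has_real_derivative y' x) (at x)"
      "\<And>x. x > 0 \<Longrightarrow> (y' has_real_derivative q x * y x) (at x)"
    and init: "y 0 = 0" "y' 0 = 0" and "x \<ge> 0"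
  shows "y x = 0"
proof -
  have "bounded (q ` {0..x})"
    using cont(3) by (intro compact_imp_bounded compact_continuous_image)
      (auto intro: continuous_on_subset)
  then obtain M where "\<forall>t\<in>{0..x}. \<bar>q t\<bar> \<le> M"
    unfolding bounded_iff by auto
  then have M: "\<bar>q t\<bar> \<le> M" if "t \<in> {0..x}" for t using that by blast
  define E where "E t = ((y t)\<^sup>2 + (y' t)\<^sup>2) * exp (- (1 + M) * t)" for t
  have "E x \<le> E 0"
  proof (rule DERIV_nonpos_imp_decreasing_open[OF \<open>x \<ge> 0\<close>])
    show "continuous_on {0..x} E"
      unfolding E_def using cont
      by (auto intro!: continuous_intros intro: continuous_on_subset)
    fix t assume t: "0 < t" "t < x"
    have "(E has_real_derivative (2 * y t * y' t * (1 + q t) - (1 + M) * ((y t)\<^sup>2 + (y' t)\<^sup>2)) * exp (- (1 + M) * t)) (at t)"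
      unfolding E_def[abs_def] using d[OF t(1)]
      by (auto intro!: derivative_eq_intros simp: algebra_simps)
    moreover have "2 * y t * y' t * (1 + q t) \<le> (1 + M) * ((y t)\<^sup>2 + (y' t)\<^sup>2)"
    proof -
      have "2 * y t * y' t * (1 + q t) \<le> \<bar>1 + q t\<bar> * \<bar>2 * y t * y' t\<bar>"
        by (metis abs_ge_self abs_mult mult.commute)
      also have "\<dots> \<le> (1 + M) * ((y t)\<^sup>2 + (y' t)\<^sup>2)"
      proof (rule mult_mono)
        show "\<bar>2 * y t * y' t\<bar> \<le> (y t)\<^sup>2 + (y' t)\<^sup>2"
          using zero_le_power2[of "\<bar>y t\<bar> - \<bar>y' t\<bar>"] by (simp add: power2_diff abs_mult)
      qed (use M[of t] t in auto)
      finally show ?thesis .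
    qed
    ultimately show "\<exists>D. (E has_real_derivative D) (at t) \<and> D \<le> 0"
      by (auto intro!: exI mult_nonpos_nonneg)
  qed
  then have "(y x)\<^sup>2 + (y' x)\<^sup>2 \<le> 0" by (simp add: E_def init mult_le_0_iff)
  then show ?thesis by (simp add: sum_power2_le_zero_iff)
qed

section \<open>The eigenvalue condition\<close>

text \<open>This is sqrt (2 pi) D_\<nu>(z), by \<open>parabolic_cylinder_eq_cyl\<close>. The factor
  exp (z^2/4) removes the first-order term of the equation for \<open>cyl\<close>, as a Schroedinger
  equation requires.\<close>

definition pcf :: "real \<Rightarrow> real \<Rightarrow> real" where
  "pcf \<nu> z = exp (z\<^sup>2 / 4) * cyl \<nu> z"

definition pcf' :: "real \<Rightarrow> real \<Rightarrow> real" where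
  "pcf' \<nu> z = exp (z\<^sup>2 / 4) * (z / 2 * cyl \<nu> z - cyl (\<nu> + 1) z)"

text \<open>Eliminates the growing factor z, so that the decay of \<open>pcf'\<close> follows from
  the decay of \<open>pcf\<close> at the neighbouring indices.\<close>

lemma pcf'_eq: "pcf' \<nu> z = \<nu> / 2 * pcf (\<nu> - 1) z - pcf (\<nu> + 1) z / 2"
proof -
  have "\<nu> / 2 * pcf (\<nu> - 1) z = exp (z\<^sup>2 / 4) / 2 * (\<nu> * cyl (\<nu> - 1) z)" by (simp add: pcf_def)
  then show ?thesis
    unfolding cyl_recurrence by (simp add: pcf_def pcf'_def algebra_simps)
qed

lemma DERIV_pcf: "(pcf \<nu> has_real_derivative pcf' \<nu> z) (at z)"
  unfolding pcf_def[abs_def] pcf'_def by (auto intro!: derivative_eq_intros simp: algebra_simps)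

text \<open>Weber's equation, in first-order form.\<close>

lemma DERIV_pcf': "(pcf' \<nu> has_real_derivative (z\<^sup>2 / 4 - \<nu> - 1 / 2) * pcf \<nu> z) (at z)"
proof -
  have r: "cyl (\<nu> + 1 + 1) z = z * cyl (\<nu> + 1) z - (\<nu> + 1) * cyl \<nu> z"
    using cyl_recurrence[of "\<nu> + 1" z] by simp
  have "(pcf' \<nu> has_real_derivative
      z / 2 * exp (z\<^sup>2 / 4) * (z / 2 * cyl \<nu> z - cyl (\<nu> + 1) z) +
      exp (z\<^sup>2 / 4) * (1 / 2 * cyl \<nu> z + z / 2 * - cyl (\<nu> + 1) z - - cyl (\<nu> + 1 + 1) z)) (at z)"
    unfolding pcf'_def[abs_def]
    by (rule derivative_eq_intros refl | simp)+ (simp add: algebra_simps)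
  then show ?thesis
    by (rule DERIV_cong) (simp only: r pcf_def, simp add: field_simps power2_eq_square)
qed

lemma continuous_on_pcf [continuous_intros]:
  "continuous_on S f \<Longrightarrow> continuous_on S (\<lambda>x. pcf \<nu> (f x))"
  "continuous_on S f \<Longrightarrow> continuous_on S (\<lambda>x. pcf' \<nu> (f x))"
  unfolding pcf_def pcf'_def by (intro continuous_intros; simp)+

lemma pcf_tendsto_0: "(pcf \<nu> \<longlongrightarrow> 0) at_top" "(pcf' \<nu> \<longlongrightarrow> 0) at_top"
proof -
  show *: "(pcf \<nu> \<longlongrightarrow> 0) at_top" for \<nu>
    unfolding pcf_def[abs_def] by (rule cyl_exp_tendsto_0)
  have "((\<lambda>z. \<nu> / 2 * pcf (\<nu> - 1) z - pcf (\<nu> + 1) z / 2) \<longlongrightarrow> \<nu> / 2 * 0 - 0 / 2) at_top"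
    by (intro tendsto_intros *) simp
  then show "(pcf' \<nu> \<longlongrightarrow> 0) at_top" by (simp add: pcf'_eq[abs_def])
qed

lemma pcf_not_both_zero: "\<nu> \<ge> -1 \<Longrightarrow> pcf \<nu> z = 0 \<Longrightarrow> pcf' \<nu> z \<noteq> 0"
  using cyl_not_both_zero[of \<nu> z] by (auto simp: pcf_def pcf'_def)

lemma pcf_square_bound:
  obtains C where "C > 0" "\<And>z. z \<ge> a \<Longrightarrow> (pcf \<nu> z)\<^sup>2 \<le> C * gauss z"
proof -
  obtain M :: nat where M: "\<bar>\<nu>\<bar> \<le> real M" using real_arch_simple by blast
  obtain C where C: "C > 0" "\<And>\<nu> \<mu> z. \<bar>\<nu>\<bar> \<le> real M \<Longrightarrow> \<bar>\<mu>\<bar> \<le> real M \<Longrightarrow> z \<ge> a \<Longrightarrow>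
    \<bar>exp (z\<^sup>2 / 2) * cyl \<nu> z * cyl \<mu> z\<bar> \<le> C * gauss z"
    using cyl_product_bound[of M a] by metis
  show ?thesis
  proof (rule that[OF C(1)])
    fix z assume z: "z \<ge> a"
    have "exp (z\<^sup>2 / 2) = exp (z\<^sup>2 / 4) * exp (z\<^sup>2 / 4)" by (simp flip: exp_add)
    then have "(pcf \<nu> z)\<^sup>2 = exp (z\<^sup>2 / 2) * cyl \<nu> z * cyl \<nu> z"
      by (simp add: pcf_def power2_eq_square mult_ac)
    also have "\<dots> \<le> C * gauss z" using C(2)[OF M M z] by linarith
    finally show "(pcf \<nu> z)\<^sup>2 \<le> C * gauss z" .
  qed
qed

text \<open>Used with a = \<gamma>, b = s on the right half line, and with a = -\<beta> on the left
  one: b = 1 after the reflection x -> -x, b = -1 without it.\<close>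

lemma pcf_affine_ode:
  fixes a b \<nu> :: real
  defines "p \<equiv> \<lambda>x. pcf \<nu> (a + b * x)" and "p' \<equiv> \<lambda>x. b * pcf' \<nu> (a + b * x)"
  shows "(p has_real_derivative p' x) (at x)"
    and "(p' has_real_derivative b\<^sup>2 * ((a + b * x)\<^sup>2 / 4 - \<nu> - 1 / 2) * p x) (at x)"
    and "b > 0 \<Longrightarrow> (p \<longlongrightarrow> 0) at_top" and "b > 0 \<Longrightarrow> (p' \<longlongrightarrow> 0) at_top"
    and "continuous_on S p" and "continuous_on S p'"
proof -
  have d: "((\<lambda>x. a + b * x) has_real_derivative b) (at x)" for x
    by (auto intro!: derivative_eq_intros)
  show "(p has_real_derivative p' x) (at x)"
    using DERIV_chain2[OF DERIV_pcf d] unfolding p_def p'_def by (rule DERIV_cong) simp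
  show "(p' has_real_derivative b\<^sup>2 * ((a + b * x)\<^sup>2 / 4 - \<nu> - 1 / 2) * p x) (at x)"
    using DERIV_cmult[OF DERIV_chain2[OF DERIV_pcf' d], of b] unfolding p_def p'_def
    by (rule DERIV_cong) (simp add: power2_eq_square mult_ac)
  show "continuous_on S p" "continuous_on S p'"
    unfolding p_def p'_def by (intro continuous_intros)+
  assume "b > 0"
  then have lim: "filterlim (\<lambda>x. a + b * x) at_top at_top" by real_asymp
  show "(p \<longlongrightarrow> 0) at_top" unfolding p_def
    by (rule filterlim_compose[OF pcf_tendsto_0(1) lim])
  show "(p' \<longlongrightarrow> 0) at_top" unfolding p'_def
    using tendsto_mult_left[OF filterlim_compose[OF pcf_tendsto_0(2) lim], of b] by simp
qed

text \<open>The eigenvalue condition: the solutions decaying at \<open>+\<infinity>\<close> and at \<open>-\<infinity>\<close>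
  have vanishing Wronskian at the interface.\<close>
definition matching :: "real \<Rightarrow> real \<Rightarrow> real \<Rightarrow> real" where
  "matching \<gamma> s \<nu> = cyl (\<nu> - 1) \<gamma> * cyl (s\<^sup>2 * \<nu>) (- (\<gamma> * s)) + s * cyl (s\<^sup>2 * \<nu> - 1) (- (\<gamma> * s)) * cyl \<nu> \<gamma>"

text \<open>When the recurrence replaces index \<nu> + 1 in both derivatives, the terms with
  \<gamma> s / 2 from the two sides cancel, as the drift is continuous at 0. The remaining factor s
  \<nu> carries the trivial root \<nu> = 0 and the degeneracy at s = 0.\<close>

lemma wronskian_eq_matching:
  "s * pcf' \<nu> \<gamma> * pcf (s\<^sup>2 * \<nu>) (- (\<gamma> * s)) + pcf \<nu> \<gamma> * pcf' (s\<^sup>2 * \<nu>) (- (\<gamma> * s)) =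
     exp (\<gamma>\<^sup>2 / 4) * exp ((\<gamma> * s)\<^sup>2 / 4) * (s * \<nu>) * matching \<gamma> s \<nu>"
proof -
  have r: "cyl (\<nu> + 1) z = z * cyl \<nu> z - \<nu> * cyl (\<nu> - 1) z" for \<nu> z
    using cyl_recurrence[of \<nu> z] by simp
  show ?thesis
    unfolding pcf_def pcf'_def matching_def r
    by (simp add: algebra_simps power2_eq_square)
qed

text \<open>The Wronskians with the two decaying solutions give two linear equations for (\<psi>(0),
  \<psi>'(0)). These data are not both zero, so the determinant of the system vanishes, and it is
  the Wronskian of the two decaying solutions.\<close>

lemma matching_eq_0_if_eigenvalue:
  assumes s: "s > 0" and \<nu>: "\<nu> > 0" and ev: "is_eigenvalue (\<gamma> * s) (s\<^sup>2) (s\<^sup>2 * \<nu>)"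
  shows "matching \<gamma> s \<nu> = 0"
proof -
  define \<beta> \<eta> \<mu> where "\<beta> = \<gamma> * s" and "\<eta> = s\<^sup>2" and "\<mu> = s\<^sup>2 * \<nu>"
  obtain \<psi> where "is_eigenfunction \<beta> \<eta> \<mu> \<psi>"
    using ev unfolding is_eigenvalue_def \<beta>_def \<eta>_def \<mu>_def by blast
  then have diff: "\<And>x. \<psi> differentiable (at x)" and cont0: "isCont (deriv \<psi>) 0"
    and diff': "\<And>x. x \<noteq> 0 \<Longrightarrow> deriv \<psi> differentiable (at x)"
    and ode: "\<And>x. x \<noteq> 0 \<Longrightarrow> - deriv (deriv \<psi>) x + potential \<beta> \<eta> x * \<psi> x = (\<mu> + 1/2) * \<psi> x"
    and nz: "\<exists>x. \<psi> x \<noteq> 0" and L2: "integrable lborel (\<lambda>x. (\<psi> x)\<^sup>2)"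
    unfolding is_eigenfunction_def by blast+
  define \<psi>' where "\<psi>' = deriv \<psi>"
  define q where "q x = (potential \<beta> \<eta> x - \<mu> - 1/2)" for x
  have d1: "(\<psi> has_real_derivative \<psi>' x) (at x)" for x
    using diff[of x] unfolding \<psi>'_def by (simp add: DERIV_deriv_iff_real_differentiable)
  have d2: "(\<psi>' has_real_derivative q x * \<psi> x) (at x)" if "x \<noteq> 0" for x
  proof -
    have "deriv \<psi>' x = q x * \<psi> x"
      using ode[OF that] by (simp add: \<psi>'_def q_def algebra_simps)
    then show ?thesis
      using diff'[OF that] unfolding \<psi>'_def by (metis DERIV_deriv_iff_real_differentiable)
  qed
  have c: "continuous_on S \<psi>" "continuous_on S \<psi>'" for S
  proof -
    show "continuous_on S \<psi>"
      by (rule DERIV_continuous_on) (rule has_field_derivative_at_within[OF d1])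
    have "isCont \<psi>' x" for x
      using cont0 d2[of x] DERIV_isCont unfolding \<psi>'_def by (cases "x = 0") blast+
    then show "continuous_on S \<psi>'" by (simp add: continuous_at_imp_continuous_on)
  qed
  have d1r: "((\<lambda>x. \<psi> (- x)) has_real_derivative - \<psi>' (- x)) (at x)" for x
    using DERIV_chain2[OF d1 DERIV_minus[OF DERIV_ident], of x] by simp
  have d2r: "((\<lambda>x. - \<psi>' (- x)) has_real_derivative q (- x) * \<psi> (- x)) (at x)" if "x \<noteq> 0" for x
    using DERIV_minus[OF DERIV_chain2[OF d2 DERIV_minus[OF DERIV_ident], of x]] that by simp
  have cr: "continuous_on S (\<lambda>x. \<psi> (- x))" "continuous_on S (\<lambda>x. - \<psi>' (- x))" for S
    by (intro continuous_intros continuous_on_compose2[OF c(1)[of UNIV]]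
        continuous_on_compose2[OF c(2)[of UNIV]]; simp)+
  have L2r: "integrable lborel (\<lambda>x. (\<psi> (- x))\<^sup>2)"
    using lborel_integrable_real_affine[OF L2, of "-1" 0] by simp
  \<comment> \<open>Here \<beta> + \<eta> x = s (\<gamma> + s x), and the shift (1 - \<eta>)/2
    replaces the 1/2 of the spectral parameter by s^2/2; so the equation is Weber's in the variable
    \<gamma> + s x, with index \<nu>.\<close>
  have qr: "q x = s\<^sup>2 * ((\<gamma> + s * x)\<^sup>2 / 4 - \<nu> - 1 / 2)" if "x > 0" for x
    using that by (simp add: q_def potential_def \<beta>_def \<eta>_def \<mu>_def power2_eq_square field_simps)
  have ql: "q (- x) = 1\<^sup>2 * ((- \<beta> + 1 * x)\<^sup>2 / 4 - \<mu> - 1 / 2)" if "x > 0" for x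
    using that by (simp add: q_def potential_def power2_eq_square field_simps)
  note right = pcf_affine_ode[where a = \<gamma> and b = s and \<nu> = \<nu>]
  note left = pcf_affine_ode[where a = "- \<beta>" and b = 1 and \<nu> = \<mu>]
  have R: "\<psi> 0 * (s * pcf' \<nu> \<gamma>) = \<psi>' 0 * pcf \<nu> \<gamma>"
    using half_line_wronskian_eq_0[OF c right(5) right(6) d1 d2 right(1) _ L2 right(3,4)[OF s]]
      right(2) by (simp add: qr)
  have L: "\<psi> 0 * pcf' \<mu> (- \<beta>) = - \<psi>' 0 * pcf \<mu> (- \<beta>)"
    using half_line_wronskian_eq_0[OF cr left(5) left(6) d1r d2r left(1) _ L2r left(3,4)]
      left(2) by (simp add: ql)
  \<comment> \<open>Zero data at the interface would make \<psi> vanish on each half line by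
    uniqueness.\<close>
  have nz0: "\<psi> 0 \<noteq> 0 \<or> \<psi>' 0 \<noteq> 0"
  proof (rule ccontr)
    assume "\<not> ?thesis"
    then have 0: "\<psi> 0 = 0" "\<psi>' 0 = 0" by auto
    have d2q: "(\<psi>' has_real_derivative s\<^sup>2 * ((\<gamma> + s * x)\<^sup>2 / 4 - \<nu> - 1 / 2) * \<psi> x) (at x)" if "x > 0" for x
      using d2[of x] that unfolding qr[OF that] by simp
    have d2qr: "((\<lambda>x. - \<psi>' (- x)) has_real_derivative 1\<^sup>2 * ((- \<beta> + 1 * x)\<^sup>2 / 4 - \<mu> - 1 / 2) * \<psi> (- x)) (at x)"
      if "x > 0" for x
      using d2r[of x] that unfolding ql[OF that] by simp
    have "\<psi> x = 0" if "x \<ge> 0" for x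
      by (rule linear_ode_unique[OF c _ d1 d2q 0 that]) (auto intro!: continuous_intros)
    moreover have "\<psi> (- x) = 0" if "x \<ge> 0" for x
      by (rule linear_ode_unique[OF cr _ d1r d2qr _ _ that]) (auto intro!: continuous_intros simp: 0)
    ultimately have "\<psi> x = 0" for x by (metis linear minus_minus neg_0_le_iff_le)
    with nz show False by blast
  qed
  have "s * pcf' \<nu> \<gamma> * pcf \<mu> (- \<beta>) + pcf \<nu> \<gamma> * pcf' \<mu> (- \<beta>) = 0" (is "?W = 0")
  proof -
    have "\<psi> 0 * ?W = (\<psi> 0 * (s * pcf' \<nu> \<gamma>)) * pcf \<mu> (- \<beta>) + pcf \<nu> \<gamma> * (\<psi> 0 * pcf' \<mu> (- \<beta>))"
      by (simp add: algebra_simps)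
    then have "\<psi> 0 * ?W = 0" unfolding R L by simp
    moreover have "\<psi>' 0 * ?W = s * pcf' \<nu> \<gamma> * (\<psi>' 0 * pcf \<mu> (- \<beta>)) + (\<psi>' 0 * pcf \<nu> \<gamma>) * pcf' \<mu> (- \<beta>)"
      by (simp add: algebra_simps)
    then have "\<psi>' 0 * ?W = s * pcf' \<nu> \<gamma> * (\<psi>' 0 * pcf \<mu> (- \<beta>) + \<psi> 0 * pcf' \<mu> (- \<beta>))"
      unfolding R[symmetric] by (simp add: algebra_simps)
    then have "\<psi>' 0 * ?W = 0" unfolding L by simp
    ultimately show ?thesis using nz0 by (metis mult_eq_0_iff)
  qed
  then show ?thesis
    using wronskian_eq_matching[of s \<nu> \<gamma>] s \<nu> unfolding \<beta>_def \<mu>_def by simp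
qed

lemma DERIV_split_at:
  fixes f :: "real \<Rightarrow> real"
  assumes "(f has_real_derivative D) (at_left x)" "(f has_real_derivative D) (at_right x)"
  shows "(f has_real_derivative D) (at x)"
  using assms unfolding has_field_derivative_iff by (rule filterlim_split_at)

text \<open>A vanishing Wronskian at 0 allows the two decaying solutions to be scaled so that values
  and first derivatives agree there; the Gaussian bounds make the glued function square
  integrable.\<close>

lemma eigenvalue_if_matching_eq_0:
  assumes s: "s > 0" and \<nu>: "\<nu> > 0" and match: "matching \<gamma> s \<nu> = 0"
  shows "is_eigenvalue (\<gamma> * s) (s\<^sup>2) (s\<^sup>2 * \<nu>)"
proof -
  define \<beta> \<eta> \<mu> where "\<beta> = \<gamma> * s" and "\<eta> = s\<^sup>2" and "\<mu> = s\<^sup>2 * \<nu>"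
  have \<mu>: "\<mu> > 0" using s \<nu> by (simp add: \<mu>_def)
  define p p' where "p x = pcf \<nu> (\<gamma> + s * x)" and "p' x = s * pcf' \<nu> (\<gamma> + s * x)" for x
  define m m' where "m x = pcf \<mu> (- \<beta> + - 1 * x)" and "m' x = -1 * pcf' \<mu> (- \<beta> + - 1 * x)" for x
  note pm = p_def p'_def m_def m'_def
  have W: "p' 0 * m 0 = p 0 * m' 0"
    using wronskian_eq_matching[of s \<nu> \<gamma>] match by (simp add: pm \<beta>_def \<mu>_def)
  have nz: "p 0 \<noteq> 0 \<or> p' 0 \<noteq> 0" "m 0 \<noteq> 0 \<or> m' 0 \<noteq> 0"
    using pcf_not_both_zero[of \<nu> \<gamma>] pcf_not_both_zero[of \<mu> "- \<beta>"] s \<nu> \<mu> by (auto simp: pm)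
  \<comment> \<open>The vectors (p(0), p'(0)) and (m(0), m'(0)) are nonzero and parallel. Crosswise
    first components serve as scaling factors, unless they vanish; then the derivatives are
    used.\<close>
  obtain A B where AB: "A * p 0 = B * m 0" "A * p' 0 = B * m' 0" "A * p 0 \<noteq> 0 \<or> A * p' 0 \<noteq> 0"
  proof (cases "m 0 = 0")
    case True
    then have "p 0 = 0" "p' 0 \<noteq> 0" "m' 0 \<noteq> 0" using W nz by auto
    with True show ?thesis by (intro that[of "m' 0" "p' 0"]) auto
  next
    case False
    then show ?thesis using W nz by (intro that[of "m 0" "p 0"]) (auto simp: mult.commute)
  qed
  define \<psi> where "\<psi> x = (if x \<ge> 0 then A * p x else B * m x)" for x
  define \<psi>' where "\<psi>' x = (if x \<ge> 0 then A * p' x else B * m' x)" for x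
  note right = pcf_affine_ode[where a = \<gamma> and b = s and \<nu> = \<nu>, folded pm]
  note left = pcf_affine_ode[where a = "- \<beta>" and b = "- 1" and \<nu> = \<mu>, folded pm]
  have cont: "continuous_on UNIV \<psi>" "continuous_on UNIV \<psi>'"
  proof -
    have U: "UNIV = {0..} \<union> {..0::real}" by auto
    show "continuous_on UNIV \<psi>" "continuous_on UNIV \<psi>'"
      unfolding \<psi>_def \<psi>'_def U using AB
      by (intro continuous_on_cases continuous_intros right left; auto)+
  qed
  have d1: "(\<psi> has_real_derivative \<psi>' x) (at x)" for x
  proof (cases "x = 0")
    case False
    then consider "x > 0" | "x < 0" by linarith
    then show ?thesis
    proof cases
      case 1
      show ?thesis
        by (rule has_field_derivative_transform_within_open[where S = "{0<..}" and f = "\<lambda>x. A * p x"])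
           (use 1 DERIV_cmult[OF right(1), of A x] in \<open>auto simp: \<psi>_def \<psi>'_def\<close>)
    next
      case 2
      show ?thesis
        by (rule has_field_derivative_transform_within_open[where S = "{..<0}" and f = "\<lambda>x. B * m x"])
           (use 2 DERIV_cmult[OF left(1), of B x] in \<open>auto simp: \<psi>_def \<psi>'_def\<close>)
    qed
  next
    case True
    have "(\<psi> has_real_derivative \<psi>' 0) (at_right 0)"
    proof -
      have "((\<lambda>x. A * p x) has_real_derivative A * p' 0) (at_right 0)"
        by (rule has_field_derivative_at_within[OF DERIV_cmult[OF right(1)]])
      then have "((\<lambda>y. (A * p y - A * p 0) / (y - 0)) \<longlongrightarrow> A * p' 0) (at_right 0)"
        unfolding has_field_derivative_iff .
      moreover have "\<forall>\<^sub>F y in at_right 0. (A * p y - A * p 0) / (y - 0) = (\<psi> y - \<psi> 0) / (y - 0)"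
        by (simp add: eventually_at_filter \<psi>_def)
      ultimately have "((\<lambda>y. (\<psi> y - \<psi> 0) / (y - 0)) \<longlongrightarrow> A * p' 0) (at_right 0)"
        by (rule Lim_transform_eventually)
      then show ?thesis
        unfolding has_field_derivative_iff by (simp add: \<psi>'_def)
    qed
    moreover have "(\<psi> has_real_derivative \<psi>' 0) (at_left 0)"
    proof -
      have "((\<lambda>x. B * m x) has_real_derivative B * m' 0) (at_left 0)"
        by (rule has_field_derivative_at_within[OF DERIV_cmult[OF left(1)]])
      then have "((\<lambda>y. (B * m y - B * m 0) / (y - 0)) \<longlongrightarrow> B * m' 0) (at_left 0)"
        unfolding has_field_derivative_iff .
      moreover have "\<forall>\<^sub>F y in at_left 0. (B * m y - B * m 0) / (y - 0) = (\<psi> y - \<psi> 0) / (y - 0)"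
        using AB by (simp add: eventually_at_filter \<psi>_def)
      ultimately have "((\<lambda>y. (\<psi> y - \<psi> 0) / (y - 0)) \<longlongrightarrow> B * m' 0) (at_left 0)"
        by (rule Lim_transform_eventually)
      then show ?thesis
        unfolding has_field_derivative_iff using AB by (simp add: \<psi>'_def)
    qed
    ultimately show ?thesis using True by (simp add: DERIV_split_at)
  qed
  have d2: "(\<psi>' has_real_derivative (potential \<beta> \<eta> x - \<mu> - 1/2) * \<psi> x) (at x)" if "x \<noteq> 0" for x
  proof -
    from that consider "x > 0" | "x < 0" by linarith
    then show ?thesis
    proof cases
      case 1
      have "(\<psi>' has_real_derivative A * (s\<^sup>2 * ((\<gamma> + s * x)\<^sup>2 / 4 - \<nu> - 1 / 2) * p x)) (at x)"
        by (rule has_field_derivative_transform_within_open[where S = "{0<..}" and f = "\<lambda>x. A * p' x"])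
           (use 1 DERIV_cmult[OF right(2), of A x] in \<open>auto simp: \<psi>'_def\<close>)
      moreover have "s\<^sup>2 * ((\<gamma> + s * x)\<^sup>2 / 4 - \<nu> - 1 / 2) = potential \<beta> \<eta> x - \<mu> - 1/2"
        using 1 by (simp add: potential_def \<beta>_def \<eta>_def \<mu>_def power2_eq_square field_simps)
      ultimately show ?thesis using 1 by (simp only: \<psi>_def) (simp add: mult_ac)
    next
      case 2
      have "(\<psi>' has_real_derivative B * ((- 1)\<^sup>2 * ((- \<beta> + - 1 * x)\<^sup>2 / 4 - \<mu> - 1 / 2) * m x)) (at x)"
        by (rule has_field_derivative_transform_within_open[where S = "{..<0}" and f = "\<lambda>x. B * m' x"])
           (use 2 DERIV_cmult[OF left(2), of B x] in \<open>auto simp: \<psi>'_def\<close>)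
      moreover have "(- 1)\<^sup>2 * ((- \<beta> + - 1 * x)\<^sup>2 / 4 - \<mu> - 1 / 2) = potential \<beta> \<eta> x - \<mu> - 1/2"
        using 2 by (simp add: potential_def power2_eq_square field_simps)
      ultimately show ?thesis using 2 by (simp only: \<psi>_def) (simp add: mult_ac)
    qed
  qed
  have deriv: "deriv \<psi> = \<psi>'" using d1 by (auto intro: DERIV_imp_deriv)
  have L2: "integrable lborel (\<lambda>x. (\<psi> x)\<^sup>2)"
  proof -
    obtain C1 where C1: "C1 > 0" "\<And>z. z \<ge> \<gamma> \<Longrightarrow> (pcf \<nu> z)\<^sup>2 \<le> C1 * gauss z"
      using pcf_square_bound[of \<gamma> \<nu>] by metis
    obtain C2 where C2: "C2 > 0" "\<And>z. z \<ge> - \<beta> \<Longrightarrow> (pcf \<mu> z)\<^sup>2 \<le> C2 * gauss z"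
      using pcf_square_bound[of "- \<beta>" \<mu>] by metis
    show ?thesis
    proof (rule Bochner_Integration.integrable_bound)
      show "integrable lborel (\<lambda>x. A\<^sup>2 * (C1 * gauss (\<gamma> + s * x)) + B\<^sup>2 * (C2 * gauss (- \<beta> + - 1 * x)))"
        using s by (intro Bochner_Integration.integrable_add integrable_mult_right
            lborel_integrable_real_affine integrable_gauss) auto
      show "(\<lambda>x. (\<psi> x)\<^sup>2) \<in> borel_measurable lborel"
        using borel_measurable_continuous_onI[OF cont(1)] by simp
      show "AE x in lborel. norm ((\<psi> x)\<^sup>2) \<le> norm (A\<^sup>2 * (C1 * gauss (\<gamma> + s * x)) + B\<^sup>2 * (C2 * gauss (- \<beta> + - 1 * x)))"
      proof (rule AE_I2)
        fix x
        have g: "gauss z \<ge> 0" for z by (simp add: gauss_def)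
        have nn: "A\<^sup>2 * (C1 * gauss (\<gamma> + s * x)) \<ge> 0" "B\<^sup>2 * (C2 * gauss (- \<beta> + - 1 * x)) \<ge> 0"
          using C1 C2 g by (intro mult_nonneg_nonneg; simp)+
        have "(\<psi> x)\<^sup>2 \<le> A\<^sup>2 * (C1 * gauss (\<gamma> + s * x)) + B\<^sup>2 * (C2 * gauss (- \<beta> + - 1 * x))"
        proof (cases "x \<ge> 0")
          case True
          then have "(\<psi> x)\<^sup>2 \<le> A\<^sup>2 * (C1 * gauss (\<gamma> + s * x))"
            using C1(2)[of "\<gamma> + s * x"] s
            by (simp add: \<psi>_def p_def power_mult_distrib mult_left_mono)
          then show ?thesis using nn by linarith
        next
          case False
          then have "(\<psi> x)\<^sup>2 \<le> B\<^sup>2 * (C2 * gauss (- \<beta> + - 1 * x))"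
            using C2(2)[of "- \<beta> + - 1 * x"]
            by (simp add: \<psi>_def m_def power_mult_distrib mult_left_mono)
          then show ?thesis using nn by linarith
        qed
        then show "norm ((\<psi> x)\<^sup>2) \<le> norm (A\<^sup>2 * (C1 * gauss (\<gamma> + s * x)) + B\<^sup>2 * (C2 * gauss (- \<beta> + - 1 * x)))"
          using nn by (simp only: real_norm_def abs_of_nonneg zero_le_power2 add_nonneg_nonneg)
      qed
    qed
  qed
  have nonzero: "\<exists>x. \<psi> x \<noteq> 0"
  proof (rule ccontr)
    assume "\<not> ?thesis"
    then have "\<psi> = (\<lambda>_. 0)" by auto
    then have "\<psi>' 0 = 0" "\<psi> 0 = 0" using deriv by auto
    then have "A * p' 0 = 0" "A * p 0 = 0" by (simp_all add: \<psi>_def \<psi>'_def)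
    with AB(3) show False by blast
  qed
  have "is_eigenfunction \<beta> \<eta> \<mu> \<psi>"
    unfolding is_eigenfunction_def deriv
  proof (intro conjI allI impI)
    show "\<psi> differentiable (at x)" for x using d1 real_differentiable_def by blast
    show "isCont \<psi> 0" "isCont \<psi>' 0" using cont by (simp_all add: continuous_on_eq_continuous_at)
    fix x :: real assume "x \<noteq> 0"
    show "\<psi>' differentiable (at x)" using d2[OF \<open>x \<noteq> 0\<close>] real_differentiable_def by blast
    show "- deriv \<psi>' x + potential \<beta> \<eta> x * \<psi> x = (\<mu> + 1/2) * \<psi> x"
      using DERIV_imp_deriv[OF d2[OF \<open>x \<noteq> 0\<close>]] by (simp add: algebra_simps)
  qed (use L2 nonzero in auto)
  then show ?thesis unfolding is_eigenvalue_def \<beta>_def \<eta>_def \<mu>_def by blast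
qed

section \<open>The limit\<close>

lemma continuous_on_matching:
  assumes "continuous_on S f" "continuous_on S g"
  shows "continuous_on S (\<lambda>x. matching \<gamma> (f x) (g x))"
  unfolding matching_def by (intro continuous_intros assms)

text \<open>A negative value slightly beyond \<mu> + 1 and positivity on [0, \<mu> + 1 - e] both
  hold at s = 0 and persist for small s > 0. So a zero exists between these places and none occurs
  before; hence there is a smallest one, and it is trapped near \<mu> + 1.\<close>

lemma smallest_matching_zero_near:
  assumes \<mu>: "\<mu> > 0" "cyl \<mu> \<gamma> = 0" and below: "\<And>\<nu>. -1 \<le> \<nu> \<Longrightarrow> \<nu> < \<mu> \<Longrightarrow> cyl \<nu> \<gamma> > 0"
    and "\<epsilon> > 0"
  shows "\<forall>\<^sub>F s in at_right 0. \<exists>r. is_smallest_positive (\<lambda>\<nu>. matching \<gamma> s \<nu> = 0) r \<and> \<bar>r - (\<mu> + 1)\<bar> < \<epsilon>"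
proof -
  \<comment> \<open>The cap \<mu>/2 keeps \<mu> + 1 - e positive.\<close>
  define e where "e = min \<epsilon> (\<mu> / 2)"
  have e: "e > 0" "e \<le> \<epsilon>" "e < \<mu> + 1" using \<mu> \<open>\<epsilon> > 0\<close> by (auto simp: e_def)
  obtain \<nu>1 where \<nu>1: "\<mu> < \<nu>1" "\<nu>1 < \<mu> + e" "cyl \<nu>1 \<gamma> < 0"
    using cyl_sign_change[OF \<mu> below e(1)] by blast
  define r1 where "r1 = \<nu>1 + 1"
  have m0: "matching \<gamma> 0 \<nu> = cyl (\<nu> - 1) \<gamma> * cyl 0 0" for \<nu> by (simp add: matching_def)
  have c0: "cyl 0 0 > 0" by (rule cyl_pos) auto
  have "isCont (\<lambda>s. matching \<gamma> s r1) 0"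
    using continuous_on_matching[of UNIV "\<lambda>s. s" "\<lambda>_. r1" \<gamma>]
    by (simp add: continuous_on_eq_continuous_at)
  then have "((\<lambda>s. matching \<gamma> s r1) \<longlongrightarrow> matching \<gamma> 0 r1) (at_right 0)"
    unfolding isCont_def by (rule tendsto_mono[rotated]) (simp add: at_le)
  moreover have "matching \<gamma> 0 r1 < 0" using \<nu>1 c0 by (simp add: m0 r1_def mult_neg_pos)
  ultimately have neg: "\<forall>\<^sub>F s in at_right 0. matching \<gamma> s r1 < 0" by (rule order_tendstoD(2))
  have "open {p. 0 < matching \<gamma> (fst p) (snd p)}"
    by (intro open_Collect_less continuous_on_matching continuous_intros)
  \<comment> \<open>The index \<nu> - 1 then ranges over [-1, \<mu> - e], where \<open>below\<close>
    applies. Compactness of the \<nu>-interval is what lets the tube lemma give one neighbourhood of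
    s = 0 for all \<nu>.\<close>
  moreover have "{0} \<times> {0..\<mu> + 1 - e} \<subseteq> {p. 0 < matching \<gamma> (fst p) (snd p)}"
    using below e c0 by (auto simp: m0)
  ultimately obtain V where V: "open V" "0 \<in> V" "V \<times> {0..\<mu> + 1 - e} \<subseteq> {p. 0 < matching \<gamma> (fst p) (snd p)}"
    using Elementary_Topology.tube_lemma[of "{0..\<mu> + 1 - e}" "{p. 0 < matching \<gamma> (fst p) (snd p)}" 0] by blast
  have "\<forall>\<^sub>F s in at_right 0. s \<in> V"
    using V eventually_nhds_in_open[of V 0] by (simp add: eventually_at_filter eventually_mono)
  with neg show ?thesis
  proof eventually_elim
    case (elim s)
    have pos: "matching \<gamma> s \<nu> > 0" if "0 \<le> \<nu>" "\<nu> \<le> \<mu> + 1 - e" for \<nu>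
    proof -
      have "(s, \<nu>) \<in> {p. 0 < matching \<gamma> (fst p) (snd p)}"
        by (rule subsetD[OF V(3)]) (use elim(2) that in simp)
      then show ?thesis by simp
    qed
    have "\<mu> + 1 - e \<le> r1" using \<nu>1 e by (simp add: r1_def)
    then obtain x where x: "\<mu> + 1 - e \<le> x" "x \<le> r1" "matching \<gamma> s x = 0"
      using IVT2'[of "matching \<gamma> s" r1 0 "\<mu> + 1 - e"] elim(1) pos[of "\<mu> + 1 - e"] e
        continuous_on_matching[of "{\<mu> + 1 - e..r1}" "\<lambda>_. s" "\<lambda>x. x" \<gamma>]
      by (auto simp: continuous_on_const continuous_on_id)
    \<comment> \<open>The end point 0 is included to make the set closed, so that its infimum is
      attained; \<open>pos\<close> keeps the infimum away from 0.\<close>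
    define Z where "Z = {0..r1} \<inter> {\<nu>. matching \<gamma> s \<nu> = 0}"
    have "x \<in> Z" using x e by (simp add: Z_def)
    moreover have "closed Z"
      unfolding Z_def by (intro closed_Int closed_Collect_eq continuous_on_matching continuous_intros)
    moreover have "bdd_below Z" unfolding Z_def by simp
    ultimately have Z: "closed Z" "Z \<noteq> {}" "bdd_below Z" by auto
    define r where "r = Inf Z"
    have r: "r \<in> Z" unfolding r_def using Z by (intro closed_contains_Inf)
    have gt: "r > \<mu> + 1 - e" using r pos[of r] by (force simp: Z_def)
    have min: "r \<le> y" if "0 < y" "matching \<gamma> s y = 0" for y
    proof (cases "y \<le> r1")
      case True
      then show ?thesis using that Z(3) unfolding r_def by (intro cInf_lower) (auto simp: Z_def)
    next
      case False
      then show ?thesis using r by (auto simp: Z_def)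
    qed
    have "is_smallest_positive (\<lambda>\<nu>. matching \<gamma> s \<nu> = 0) r"
      unfolding is_smallest_positive_def using min gt e r by (auto simp: Z_def)
    moreover have "\<bar>r - (\<mu> + 1)\<bar> < \<epsilon>" using gt r \<nu>1 e by (auto simp: Z_def r1_def)
    ultimately show ?case by blast
  qed
qed

text \<open>Every positive y is s^2 \<nu> with \<nu> > 0, and this scaling preserves order. A
  minimum is unique, so the definite description in \<open>spectral_gap\<close> denotes it.\<close>

lemma smallest_eigenvalue:
  assumes s: "s > 0" and r: "is_smallest_positive (\<lambda>\<nu>. matching \<gamma> s \<nu> = 0) r"
  shows "is_smallest_positive (is_eigenvalue (\<gamma> * s) (s\<^sup>2)) (s\<^sup>2 * r)"
    and "spectral_gap (\<gamma> * s) (s\<^sup>2) = s\<^sup>2 * r"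
proof -
  have iff: "is_eigenvalue (\<gamma> * s) (s\<^sup>2) (s\<^sup>2 * \<nu>) \<longleftrightarrow> matching \<gamma> s \<nu> = 0" if "\<nu> > 0" for \<nu>
    using matching_eq_0_if_eigenvalue[OF s that] eigenvalue_if_matching_eq_0[OF s that] by blast
  show *: "is_smallest_positive (is_eigenvalue (\<gamma> * s) (s\<^sup>2)) (s\<^sup>2 * r)"
    unfolding is_smallest_positive_def
  proof (intro conjI allI impI)
    show "0 < s\<^sup>2 * r" "is_eigenvalue (\<gamma> * s) (s\<^sup>2) (s\<^sup>2 * r)"
      using r s iff by (auto simp: is_smallest_positive_def)
    fix y assume y: "0 < y \<and> is_eigenvalue (\<gamma> * s) (s\<^sup>2) y"
    define \<nu> where "\<nu> = y / s\<^sup>2"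
    have "y = s\<^sup>2 * \<nu>" "\<nu> > 0" using s y by (auto simp: \<nu>_def)
    then have "r \<le> \<nu>" using y iff r by (auto simp: is_smallest_positive_def)
    then show "s\<^sup>2 * r \<le> y" unfolding \<open>y = s\<^sup>2 * \<nu>\<close> by (intro mult_left_mono) auto
  qed
  show "spectral_gap (\<gamma> * s) (s\<^sup>2) = s\<^sup>2 * r"
    unfolding spectral_gap_def
  proof (rule the_equality[of "is_smallest_positive (is_eigenvalue (\<gamma> * s) (s\<^sup>2))", OF *])
    fix x assume "is_smallest_positive (is_eigenvalue (\<gamma> * s) (s\<^sup>2)) x"
    with * show "x = s\<^sup>2 * r" unfolding is_smallest_positive_def by (meson order_antisym)
  qed
qed

text \<open>The recurrence gives \<gamma> \<open>cyl \<nu> \<gamma>\<close> -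
  \<open>cyl (\<nu> + 1) \<gamma>\<close> = \<nu> \<open>cyl (\<nu> - 1) \<gamma>\<close>. The
  factor \<nu> is the trivial solution that the word positive excludes in the definition of
  R.\<close>

lemma parabolic_cylinder_equation_iff:
  assumes "c > 0"
  shows "of_real \<gamma> * parabolic_cylinder c (of_real \<nu>) (of_real \<gamma>) =
      parabolic_cylinder c (1 + of_real \<nu>) (of_real \<gamma>) \<longleftrightarrow> \<nu> * cyl (\<nu> - 1) \<gamma> = 0"
proof -
  define k where "k = exp (\<gamma>\<^sup>2 / 4) / sqrt (2 * pi)"
  have "k \<noteq> 0" by (simp add: k_def)
  have "of_real \<gamma> * parabolic_cylinder c (of_real \<nu>) (of_real \<gamma>) = of_real (k * (\<gamma> * cyl \<nu> \<gamma>))"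
    unfolding parabolic_cylinder_eq_cyl[OF assms] by (simp add: k_def)
  moreover have "parabolic_cylinder c (1 + of_real \<nu>) (of_real \<gamma>) = of_real (k * cyl (\<nu> + 1) \<gamma>)"
    using parabolic_cylinder_eq_cyl[OF assms, of "\<nu> + 1" \<gamma>] by (simp add: k_def add.commute)
  ultimately have "of_real \<gamma> * parabolic_cylinder c (of_real \<nu>) (of_real \<gamma>) =
      parabolic_cylinder c (1 + of_real \<nu>) (of_real \<gamma>) \<longleftrightarrow> k * (\<gamma> * cyl \<nu> \<gamma>) = k * cyl (\<nu> + 1) \<gamma>"
    by (simp only: of_real_eq_iff)
  then show ?thesis using \<open>k \<noteq> 0\<close> cyl_recurrence[of \<nu> \<gamma>] by auto
qed

theorem proposition7:
  fixes \<gamma> c :: real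
  assumes "c > 0"
  shows "\<exists>R. is_smallest_positive
               (\<lambda>\<nu>. complex_of_real \<gamma> * parabolic_cylinder c (complex_of_real \<nu>) (complex_of_real \<gamma>) =
                    parabolic_cylinder c (1 + complex_of_real \<nu>) (complex_of_real \<gamma>)) R \<and>
             (\<forall>\<^sub>F \<eta> in at_right 0. is_smallest_positive (is_eigenvalue (\<gamma> * sqrt \<eta>) \<eta>)
                                     (spectral_gap (\<gamma> * sqrt \<eta>) \<eta>)) \<and>
             (\<lambda>\<eta>. spectral_gap (\<gamma> * sqrt \<eta>) \<eta>) \<sim>[at_right 0] (\<lambda>\<eta>. \<eta> * R)"
proof -
  obtain \<mu> where \<mu>: "\<mu> > 0" "cyl \<mu> \<gamma> = 0" and below: "\<And>\<nu>. -1 \<le> \<nu> \<Longrightarrow> \<nu> < \<mu> \<Longrightarrow> cyl \<nu> \<gamma> > 0"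
    using first_cyl_zero[of \<gamma>] by metis
  define R where "R = \<mu> + 1"
  have sqrt: "filterlim sqrt (at_right 0) (at_right 0)"
    by real_asymp
  have near: "\<forall>\<^sub>F \<eta> in at_right 0. \<exists>r. \<bar>r - R\<bar> < \<epsilon> \<and> spectral_gap (\<gamma> * sqrt \<eta>) \<eta> = \<eta> * r \<and>
      is_smallest_positive (is_eigenvalue (\<gamma> * sqrt \<eta>) \<eta>) (spectral_gap (\<gamma> * sqrt \<eta>) \<eta>)"
    if "\<epsilon> > 0" for \<epsilon>
  proof -
    have "\<forall>\<^sub>F \<eta> in at_right 0. \<exists>r. is_smallest_positive (\<lambda>\<nu>. matching \<gamma> (sqrt \<eta>) \<nu> = 0) r \<and> \<bar>r - R\<bar> < \<epsilon>"
      using eventually_compose_filterlim[OF smallest_matching_zero_near[OF \<mu> below that] sqrt]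
      unfolding R_def .
    then show ?thesis
      using eventually_at_right_less[of "0::real"]
    proof eventually_elim
      case (elim \<eta>)
      then obtain r where r: "is_smallest_positive (\<lambda>\<nu>. matching \<gamma> (sqrt \<eta>) \<nu> = 0) r" "\<bar>r - R\<bar> < \<epsilon>"
        by blast
      have "sqrt \<eta> > 0" "(sqrt \<eta>)\<^sup>2 = \<eta>" using elim by auto
      with smallest_eigenvalue[OF _ r(1)] r(2) show ?case by auto
    qed
  qed
  have "is_smallest_positive
      (\<lambda>\<nu>. complex_of_real \<gamma> * parabolic_cylinder c (complex_of_real \<nu>) (complex_of_real \<gamma>) =
           parabolic_cylinder c (1 + complex_of_real \<nu>) (complex_of_real \<gamma>)) R"
    unfolding parabolic_cylinder_equation_iff[OF assms] is_smallest_positive_def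
  proof (intro conjI allI impI)
    show "0 < R" "R * cyl (R - 1) \<gamma> = 0" using \<mu> by (auto simp: R_def)
    fix y assume y: "0 < y \<and> y * cyl (y - 1) \<gamma> = 0"
    show "R \<le> y"
    proof (rule ccontr)
      assume "\<not> R \<le> y"
      then have "cyl (y - 1) \<gamma> > 0" using y by (intro below) (auto simp: R_def)
      with y show False by auto
    qed
  qed
  moreover have "\<forall>\<^sub>F \<eta> in at_right 0. is_smallest_positive (is_eigenvalue (\<gamma> * sqrt \<eta>) \<eta>)
      (spectral_gap (\<gamma> * sqrt \<eta>) \<eta>)"
    using near[of 1] by (auto elim: eventually_mono)
  moreover have "(\<lambda>\<eta>. spectral_gap (\<gamma> * sqrt \<eta>) \<eta>) \<sim>[at_right 0] (\<lambda>\<eta>. \<eta> * R)"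
  proof (rule asymp_equivI')
    have "((\<lambda>\<eta>. spectral_gap (\<gamma> * sqrt \<eta>) \<eta> / \<eta>) \<longlongrightarrow> R) (at_right 0)"
    proof (rule tendstoI)
      fix \<epsilon> :: real assume "\<epsilon> > 0"
      show "\<forall>\<^sub>F \<eta> in at_right 0. dist (spectral_gap (\<gamma> * sqrt \<eta>) \<eta> / \<eta>) R < \<epsilon>"
        using near[OF \<open>\<epsilon> > 0\<close>] eventually_at_right_less[of "0::real"]
        by eventually_elim (auto simp: dist_real_def)
    qed
    then have "((\<lambda>\<eta>. spectral_gap (\<gamma> * sqrt \<eta>) \<eta> / \<eta> / R) \<longlongrightarrow> R / R) (at_right 0)"
      using \<mu> by (intro tendsto_divide) (auto simp: R_def)
    then show "((\<lambda>\<eta>. spectral_gap (\<gamma> * sqrt \<eta>) \<eta> / (\<eta> * R)) \<longlongrightarrow> 1) (at_right 0)"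
      using \<mu> by (simp add: R_def)
  qed
  ultimately show ?thesis by blast
qed

end
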